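(* Let $(X,\varphi)$ be a bounded $N$-dimensional Lattice EDS with $N=1$ or $2$, and assume $X$ is compact (and non-empty). Let $\mathcal{E}\subset X$ be the set of stationary points of $\varphi$ and let $\mathcal{U}$ be any open neighbourhood of $\mathcal{E}$. Then for every $u\in X$, with $u(t)=\varphi(u,t)$, $$\lim_{T\to\infty}\frac1T\int_0^T 1_{\mathcal{U}}(u(t))\,dt=1,$$ where $1_{\mathcal{U}}$ is the characteristic function of $\mathcal{U}$. In particular, $\mathcal{E}$ is non-empty.
   Context: Notation: $\varepsilon_1,\dots,\varepsilon_N$ is the standard basis of $\mathbb{Z}^N$; for $v:\mathbb{Z}^N\to\mathbb{R}^N$, $\operatorname{div} v(\alpha)=\sum_{j=1}^N \big(v_j(\alpha)-v_j(\alpha-\varepsilon_j)\big)$; $l_\infty(\mathbb{Z}^N)$ is the space of bounded functions $\mathbb{Z}^N\to\mathbb{R}$ with sup-norm $\|\cdot\|_\infty$; $\mathbb{R}^+=[0,\infty)$. Definition (Lattice EDS). Let $X$ be a metrizable space and $\varphi$ a continuous semiflow on $X$; write $u(t)=\varphi(u,t)$, $t\ge 0$. A point $u\in X$ is stationary (an equilibrium) if $\varphi(u,t)=u$ for all $t\ge 0$. $(X,\varphi)$ is an $N$-dimensional extended dissipative system on a lattice (Lattice EDS) if there are functions $e,d,f_1,\dots,f_N:X\to l_\infty(\mathbb{Z}^N)$ (energy, dissipation, flux $f=(f_1,\dots,f_N)$), written $u\mapsto e_u,d_u,f_u$, such that: (A1) $e_u(\alpha)\ge 0$, $d_u(\alpha)\geq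 0$ for all $u\in X$, $\alpha\in\mathbb{Z}^N$. (A2) For each $\alpha$, the maps $u\mapsto e_u(\alpha),d_u(\alpha),(f_1)_u(\alpha),\dots,(f_N)_u(\alpha)$ are continuous $X\to\mathbb{R}$; and for each $u\in X$ the maps $t\mapsto\|e_{u(t)}\|_\infty,\|d_{u(t)}\|_\infty,\|f_{u(t)}\|_\infty$ are continuous $\mathbb{R}^+\to\mathbb{R}^+$. (A3) If $d_u\equiv 0$ then $u$ is stationary. (A4) Along each semiorbit $u(t)$ and at each $\alpha$, $\partial_t e_{u(t)}(\alpha)=-d_{u(t)}(\alpha)+\operatorname{div} f_{u(t)}(\alpha)$, with $\partial_t$ in the sense of distributions. (A5) There is a non-decreasing $b:\mathbb{R}^+\to\mathbb{R}^+$ such that $|f_u(\alpha)|^2\le b(\|e_u\|_\infty)\, d_u(\alpha)$ for all $u\in X$, $\alpha\in\mathbb{Z}^N$. The Lattice EDS is bounded if $\sup_{u\in X}\|e_u\|_\infty<\infty$. *)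

theory Defs
  imports "HOL-Analysis.Analysis"
begin

definition l_infinity :: "('a \<Rightarrow> 'b::real_normed_vector) set" where
  "l_infinity = {g. bounded (range g)}"

text \<open>Only meaningful on \<^const>\<open>l_infinity\<close>; vector-valued functions are
  measured with the Euclidean norm of their values.\<close>
definition sup_norm :: "('a \<Rightarrow> 'b::real_normed_vector) \<Rightarrow> real" where
  "sup_norm g = (SUP \<alpha>. norm (g \<alpha>))"

definition lattice_div :: "(int ^ 'n \<Rightarrow> real ^ 'n) \<Rightarrow> int ^ 'n \<Rightarrow> real" where
  "lattice_div v \<alpha> = (\<Sum>j\<in>UNIV. v \<alpha> $ j - v (\<alpha> - axis j 1) $ j)"

definition test_function :: "(real \<Rightarrow> real) \<Rightarrow> bool" where
  "test_function \<psi> \<longleftrightarrow>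
     (\<forall>k. (deriv ^^ k) \<psi> differentiable_on UNIV) \<and>
     (\<exists>a b. 0 < a \<and> (\<forall>t. t \<notin> {a..b} \<longrightarrow> \<psi> t = 0))"

text \<open>The derivative of \<open>g\<close> in the sense of distributions on the open half-line is \<open>h\<close>, for
  locally integrable \<open>g\<close> and \<open>h\<close>. It is used below only for functions continuous on
  \<open>[0, \<infinity>)\<close>, for which both integrals exist.\<close>
definition has_distributional_derivative :: "(real \<Rightarrow> real) \<Rightarrow> (real \<Rightarrow> real) \<Rightarrow> bool" where
  "has_distributional_derivative g h \<longleftrightarrow>
     (\<forall>\<psi>. test_function \<psi> \<longrightarrow>
        - (LINT t:{0<..}|lborel. g t * deriv \<psi> t) = (LINT t:{0<..}|lborel. h t * \<psi> t))"

text \<open>Times are real numbers, but nothing is assumed about \<open>\<phi> u t\<close> for \<open>t < 0\<close> or for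
  \<open>u\<close> outside the carrier.\<close>
locale continuous_semiflow =
  fixes X :: "'x topology" and \<phi> :: "'x \<Rightarrow> real \<Rightarrow> 'x"
  assumes continuous_flow:
      "continuous_map (prod_topology X (top_of_set {0..})) X (\<lambda>(u, t). \<phi> u t)"
    and flow_zero: "u \<in> topspace X \<Longrightarrow> \<phi> u 0 = u"
    and flow_add: "\<lbrakk>u \<in> topspace X; 0 \<le> s; 0 \<le> t\<rbrakk> \<Longrightarrow> \<phi> u (s + t) = \<phi> (\<phi> u s) t"

definition stationary :: "('x \<Rightarrow> real \<Rightarrow> 'x) \<Rightarrow> 'x \<Rightarrow> bool" where
  "stationary \<phi> u \<longleftrightarrow> (\<forall>t\<ge>0. \<phi> u t = u)"

definition equilibria :: "'x topology \<Rightarrow> ('x \<Rightarrow> real \<Rightarrow> 'x) \<Rightarrow> 'x set" where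
  "equilibria X \<phi> = {u \<in> topspace X. stationary \<phi> u}"

text \<open>The lattice dimension is the cardinality of the index type \<open>'n\<close>; the energy, dissipation
  and flux of \<open>u\<close> are \<open>e u\<close>, \<open>d u\<close> and \<open>f u\<close>.\<close>
locale lattice_EDS = continuous_semiflow X \<phi>
  for X :: "'x topology" and \<phi> :: "'x \<Rightarrow> real \<Rightarrow> 'x" +
  fixes e d :: "'x \<Rightarrow> int ^ 'n \<Rightarrow> real"
    and f :: "'x \<Rightarrow> int ^ 'n \<Rightarrow> real ^ 'n"
  assumes metrizable: "metrizable_space X"
    and energy_l_infinity: "u \<in> topspace X \<Longrightarrow> e u \<in> l_infinity"
    and dissipation_l_infinity: "u \<in> topspace X \<Longrightarrow> d u \<in> l_infinity"
    and flux_l_infinity: "u \<in> topspace X \<Longrightarrow> f u \<in> l_infinity"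
    and energy_nonneg: "u \<in> topspace X \<Longrightarrow> 0 \<le> e u \<alpha>"
    and dissipation_nonneg: "u \<in> topspace X \<Longrightarrow> 0 \<le> d u \<alpha>"
    and continuous_energy: "continuous_map X euclideanreal (\<lambda>u. e u \<alpha>)"
    and continuous_dissipation: "continuous_map X euclideanreal (\<lambda>u. d u \<alpha>)"
    and continuous_flux: "continuous_map X euclideanreal (\<lambda>u. f u \<alpha> $ j)"
    and continuous_energy_norm:
      "u \<in> topspace X \<Longrightarrow> continuous_on {0..} (\<lambda>t. sup_norm (e (\<phi> u t)))"
    and continuous_dissipation_norm:
      "u \<in> topspace X \<Longrightarrow> continuous_on {0..} (\<lambda>t. sup_norm (d (\<phi> u t)))"
    and continuous_flux_norm:
      "u \<in> topspace X \<Longrightarrow> continuous_on {0..} (\<lambda>t. sup_norm (f (\<phi> u t)))"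
    and no_dissipation_stationary:
      "\<lbrakk>u \<in> topspace X; \<And>\<alpha>. d u \<alpha> = 0\<rbrakk> \<Longrightarrow> stationary \<phi> u"
    and energy_balance:
      "u \<in> topspace X \<Longrightarrow> has_distributional_derivative (\<lambda>t. e (\<phi> u t) \<alpha>)
         (\<lambda>t. - d (\<phi> u t) \<alpha> + lattice_div (f (\<phi> u t)) \<alpha>)"
    and flux_bound:
      "\<exists>b. mono_on {0..} b \<and> (\<forall>x\<ge>0. 0 \<le> b x) \<and>
         (\<forall>u\<in>topspace X. \<forall>\<alpha>. (norm (f u \<alpha>))\<^sup>2 \<le> b (sup_norm (e u)) * d u \<alpha>)"

locale bounded_lattice_EDS = lattice_EDS X \<phi> e d f
  for X :: "'x topology" and \<phi> :: "'x \<Rightarrow> real \<Rightarrow> 'x"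
    and e d :: "'x \<Rightarrow> int ^ 'n \<Rightarrow> real"
    and f :: "'x \<Rightarrow> int ^ 'n \<Rightarrow> real ^ 'n" +
  assumes bounded_energy: "bdd_above ((\<lambda>u. sup_norm (e u)) ` topspace X)"

end

theory Submission imports Defs begin

text \<open>
  Fix an orbit and let \<open>D\<close> and \<open>F\<close> be the time averages over \<open>[0, T]\<close> of dissipation and flux. The
  energy balance gives \<open>D \<le> E / T + div F\<close>, and the flux bound gives \<open>\<bar>F\<bar>\<^sup>2 \<le> b D\<close>. Testing the first
  inequality with the square of a cutoff \<open>w\<close>, summing by parts and absorbing \<open>w\<^sup>2 D\<close> bounds \<open>D 0\<close> by
  \<open>E / T\<close> times the size of the support of \<open>w\<close>, plus a constant times the Dirichlet energy of \<open>w\<close>.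
  In dimension at most 2, logarithmic cutoffs have arbitrarily small Dirichlet energy (the lattice
  is recurrent), so \<open>D\<close> tends to 0 at each site. By compactness, finitely many sites detect being
  outside \<open>U\<close>, hence the fraction of time spent outside \<open>U\<close> tends to 0.
\<close>

section \<open>Distributional derivatives of continuous functions\<close>

text \<open>The polynomial \<open>P\<close> and the pole order \<open>n\<close> are parameters so
  that the family is closed under differentiation. Smoothness of every order then follows from one
  first-order statement, \<open>bump_has_derivative\<close>.\<close>

definition bump :: "real poly \<Rightarrow> nat \<Rightarrow> real \<Rightarrow> real" where
  "bump P n t = (if 0 < t \<and> t < 1 then poly P t / (t * (1 - t)) ^ n * exp (- 1 / (t * (1 - t))) else 0)"

text \<open>Apply \<open>x \<le> exp x\<close> to \<open>x = 1 / (m * s)\<close>, take the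
  \<open>m\<close>-th power and invert. As \<open>m\<close> is free, the exponential beats any pole
  in \<open>bump\<close>.\<close>

lemma exp_neg_inverse_le:
  fixes s :: real
  assumes "0 < s" "0 < m"
  shows "exp (- 1 / s) \<le> (real m * s) ^ m"
proof -
  have "(1 / s / real m) ^ m \<le> exp (1 / s / real m) ^ m"
    using assms exp_ge_add_one_self[of "1 / s / real m"]
    by (intro power_mono order_trans[OF _ exp_ge_add_one_self]) auto
  also have "\<dots> = exp (1 / s)"
    using assms by (simp add: exp_of_nat_mult[symmetric])
  finally show ?thesis
    using assms by (simp add: exp_minus field_simps power_divide power_mult_distrib)
qed

text \<open>The bound is uniform in \<open>t0\<close> outside \<open>(0, 1)\<close>, so it yields the zero derivative at the endpoints
  and beyond them alike.\<close>

lemma bump_quadratic_bound: "\<exists>C. \<forall>t. \<forall>t0\<in>- {0<..<1}. \<bar>bump P n t\<bar> \<le> C * (t - t0)\<^sup>2"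
proof -
  have "bounded (poly P ` {0..1})"
    by (intro compact_imp_bounded compact_continuous_image) (auto intro!: continuous_intros)
  then obtain K where K: "\<And>t. t \<in> {0..1} \<Longrightarrow> \<bar>poly P t\<bar> \<le> K" by (auto simp: bounded_iff) fastforce
  have K0: "0 \<le> K" using K[of 0] by auto
  \<comment> \<open>Exponent \<open>n + 2\<close> in \<open>exp_neg_inverse_le\<close>:
    \<open>n\<close> powers of \<open>s\<close> cancel the pole and two remain for the
    square.\<close>
  let ?C = "K * real (n + 2) ^ (n + 2)"
  have "\<bar>bump P n t\<bar> \<le> ?C * (t - t0)\<^sup>2" if t0: "t0 \<notin> {0<..<1}" for t t0
  proof (cases "0 < t \<and> t < 1")
    case True
    define s where "s = t * (1 - t)"
    have s: "0 < s" using True by (simp add: s_def)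
    \<comment> \<open>\<open>s\<close> is at most the distance to either endpoint, and
      \<open>t0\<close> lies at or beyond one of them.\<close>
    have "s \<le> t" "s \<le> 1 - t" using True by (auto simp: s_def mult_left_le mult_left_le_one_le)
    then have "s \<le> \<bar>t - t0\<bar>" using t0 by auto
    then have s2: "s\<^sup>2 \<le> (t - t0)\<^sup>2" using s by (simp add: abs_le_square_iff[symmetric])
    have "\<bar>bump P n t\<bar> = \<bar>poly P t\<bar> / s ^ n * exp (- 1 / s)"
      using True s by (simp add: bump_def s_def[symmetric] abs_mult)
    also have "\<dots> \<le> K / s ^ n * (real (n + 2) * s) ^ (n + 2)"
      using s K[of t] True K0 by (intro mult_mono divide_right_mono exp_neg_inverse_le) auto
    also have "\<dots> = ?C * s\<^sup>2" using s by (simp only: power_mult_distrib power_add[of s]) simp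
    also have "\<dots> \<le> ?C * (t - t0)\<^sup>2" using s2 K0 by (intro mult_left_mono) auto
    finally show ?thesis .
  next
    case False then show ?thesis using K0 by (auto simp: bump_def)
  qed
  then show ?thesis by blast
qed

lemma has_derivative_zero_of_quadratic:
  fixes F :: "real \<Rightarrow> real"
  assumes "\<And>t. \<bar>F t\<bar> \<le> C * (t - t0)\<^sup>2"
  shows "(F has_real_derivative 0) (at t0)"
proof -
  have F0: "F t0 = 0" using assms[of t0] by simp
  have "((\<lambda>h. (F (t0 + h) - F t0) / h) \<longlongrightarrow> 0) (at 0)"
  proof (rule Lim_null_comparison[where g = "\<lambda>h. C * \<bar>h\<bar>"])
    show "\<forall>\<^sub>F h in at 0. norm ((F (t0 + h) - F t0) / h) \<le> C * \<bar>h\<bar>"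
    proof (rule always_eventually, rule allI)
      fix h show "norm ((F (t0 + h) - F t0) / h) \<le> C * \<bar>h\<bar>"
        using assms[of "t0 + h"] F0
        by (cases "h = 0") (auto simp: field_simps power2_eq_square abs_mult_self_eq)
    qed
    show "((\<lambda>h. C * \<bar>h\<bar>) \<longlongrightarrow> 0) (at 0)" by (auto intro!: tendsto_eq_intros)
  qed
  then show ?thesis by (simp add: DERIV_def)
qed

lemma bump_has_derivative:
  "\<exists>Q m. \<forall>t. (bump P n has_real_derivative bump Q m t) (at t)"
proof -
  define s where "s = [:0, 1, - 1 :: real:]"
  define s' where "s' = [:1, - 2 :: real:]"
  \<comment> \<open>Quotient, product and chain rule applied to
    \<open>P / s ^ n * exp (- 1 / s)\<close>, with \<open>s ^ (n + 2)\<close> as the common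
    denominator.\<close>
  define Q where "Q = pderiv P * s\<^sup>2 - of_nat n * P * s * s' + P * s'"
  have ps: "poly s t = t * (1 - t)" for t by (simp add: s_def algebra_simps)
  have ps': "poly s' t = 1 - 2 * t" for t by (simp add: s'_def)
  have "(bump P n has_real_derivative bump Q (n + 2) t) (at t)" for t
  proof (cases "0 < t \<and> t < 1")
    case True
    define x where "x = t * (1 - t)"
    have x: "x > 0" using True by (simp add: x_def)
    have dx: "((\<lambda>t. t * (1 - t)) has_real_derivative (1 - 2 * t)) (at t)"
      by (auto intro!: derivative_eq_intros)
    have d1: "((\<lambda>t. exp (- 1 / (t * (1 - t)))) has_real_derivative
         exp (- 1 / x) * ((1 - 2 * t) / x\<^sup>2)) (at t)"
      using x unfolding x_def
      by (auto intro!: derivative_eq_intros dx simp: power2_eq_square divide_simps) (simp add: algebra_simps)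
    have d2: "((\<lambda>t. (t * (1 - t)) ^ n) has_real_derivative real n * x ^ (n - 1) * (1 - 2 * t)) (at t)"
      unfolding x_def by (rule derivative_eq_intros dx | simp)+
    have "((\<lambda>t. poly P t / (t * (1 - t)) ^ n * exp (- 1 / (t * (1 - t)))) has_real_derivative
        (poly (pderiv P) t * x ^ n - poly P t * (real n * x ^ (n - 1) * (1 - 2 * t))) / (x ^ n * x ^ n) * exp (- 1 / x)
        + exp (- 1 / x) * ((1 - 2 * t) / x\<^sup>2) * (poly P t / x ^ n)) (at t)"
      using DERIV_mult[OF DERIV_divide[OF poly_DERIV d2] d1, of P] True by (simp add: x_def)
    also have "(poly (pderiv P) t * x ^ n - poly P t * (real n * x ^ (n - 1) * (1 - 2 * t))) / (x ^ n * x ^ n) * exp (- 1 / x)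
        + exp (- 1 / x) * ((1 - 2 * t) / x\<^sup>2) * (poly P t / x ^ n) = bump Q (n + 2) t"
    proof -
      \<comment> \<open>For \<open>n = 0\<close> the exponent is truncated to 0, but the factor
        \<open>real n\<close> makes both sides vanish.\<close>
      have "real n * x ^ (n - 1) = real n * x ^ n / x" using x by (cases n) auto
      then have "(poly (pderiv P) t * x ^ n - poly P t * (real n * x ^ (n - 1) * (1 - 2 * t))) / (x ^ n * x ^ n) * exp (- 1 / x)
        + exp (- 1 / x) * ((1 - 2 * t) / x\<^sup>2) * (poly P t / x ^ n)
        = (poly (pderiv P) t * x\<^sup>2 - real n * poly P t * x * (1 - 2 * t) + poly P t * (1 - 2 * t)) / x ^ (n + 2) * exp (- 1 / x)"
        using x by (simp only:) (simp add: field_simps power2_eq_square)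
      also have "\<dots> = bump Q (n + 2) t"
        using True by (simp add: bump_def Q_def ps ps' x_def del: power_Suc)
      finally show ?thesis .
    qed
    finally show ?thesis
      by (rule has_field_derivative_transform_within_open[where S = "{0<..<1}"])
        (use True in \<open>auto simp: bump_def\<close>)
  next
    case False
    obtain C where "\<And>t'. \<bar>bump P n t'\<bar> \<le> C * (t' - t)\<^sup>2"
      using bump_quadratic_bound[of P n] False by (metis ComplI greaterThanLessThan_iff)
    then have "(bump P n has_real_derivative 0) (at t)" by (rule has_derivative_zero_of_quadratic)
    moreover have "bump Q (n + 2) t = 0" using False by (auto simp: bump_def)
    ultimately show ?thesis by simp
  qed
  then show ?thesis by blast
qed

text \<open>By induction all iterated derivatives stay in \<open>A\<close>, so smoothness reduces to
  exhibiting a class closed under one derivative.\<close>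

lemma deriv_funpow_differentiable:
  fixes A :: "(real \<Rightarrow> real) set"
  assumes A: "\<And>F. F \<in> A \<Longrightarrow> \<exists>F'\<in>A. \<forall>t. (F has_real_derivative F' t) (at t)"
    and "F \<in> A"
  shows "(deriv ^^ k) F differentiable_on UNIV"
proof -
  have "(deriv ^^ k) F \<in> A"
  proof (induction k)
    case (Suc k)
    then obtain F' where F': "F' \<in> A" "\<And>t. ((deriv ^^ k) F has_real_derivative F' t) (at t)"
      using A by blast
    have "deriv ((deriv ^^ k) F) = F'" by (rule ext) (rule DERIV_imp_deriv[OF F'(2)])
    then show ?case using F'(1) by simp
  qed (simp add: assms(2))
  then show ?thesis
    using A unfolding differentiable_on_def by (meson has_field_derivative_imp_has_derivative differentiable_def)
qed

text \<open>Supplies the closed class for the smoothed indicator: its derivative is a difference of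
  two rescaled bumps, and the chain-rule factor \<open>m\<close> is absorbed in the
  coefficients.\<close>

lemma has_real_derivative_bump_combination:
  fixes a b m :: real
  shows "\<exists>c c' P' n' Q' k'. \<forall>t. ((\<lambda>t. c1 * bump P n (m * t + a) - c2 * bump Q k (m * t + b))
     has_real_derivative c * bump P' n' (m * t + a) - c' * bump Q' k' (m * t + b)) (at t)"
proof -
  obtain P' n' where 1: "\<And>t. (bump P n has_real_derivative bump P' n' t) (at t)"
    using bump_has_derivative by blast
  obtain Q' k' where 2: "\<And>t. (bump Q k has_real_derivative bump Q' k' t) (at t)"
    using bump_has_derivative by blast
  have "((\<lambda>t. c1 * bump P n (m * t + a) - c2 * bump Q k (m * t + b)) has_real_derivative
      (c1 * m) * bump P' n' (m * t + a) - (c2 * m) * bump Q' k' (m * t + b)) (at t)" for t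
    by (rule derivative_eq_intros DERIV_chain2[OF 1] DERIV_chain2[OF 2] refl | simp)+
  then show ?thesis by blast
qed

text \<open>\<open>S\<close> is an antiderivative \<open>B\<close> of the basic bump, normalised by
  its total increase. The mean value theorem shows both that \<open>B\<close> is constant outside
  \<open>(0, 1)\<close> and that the increase is positive.\<close>

lemma smooth_step:
  obtains S :: "real \<Rightarrow> real" and c :: real where
    "\<And>t. (S has_real_derivative c * bump 1 0 t) (at t)" "0 \<le> c"
    "\<And>t. t \<le> 0 \<Longrightarrow> S t = 0" "\<And>t. 1 \<le> t \<Longrightarrow> S t = 1"
proof -
  let ?\<beta> = "bump 1 0"
  have cont: "isCont ?\<beta> t" for t using bump_has_derivative[of 1 0] DERIV_isCont by blast
  obtain B where B: "\<And>t. (B has_real_derivative ?\<beta> t) (at t)"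
    using einterval_antiderivative[of "-\<infinity>" "\<infinity>" ?\<beta>] cont
    by (auto simp: has_real_derivative_iff_has_vector_derivative)
  have nonneg: "0 \<le> ?\<beta> t" for t by (simp add: bump_def)
  have MVT: "\<exists>z. x < z \<and> z < y \<and> B y - B x = (y - x) * ?\<beta> z" if "x < y" for x y
    using MVT2[OF that] B by blast
  have B0: "B t = B 0" if "t \<le> 0" for t
    using MVT[of t 0] that by (cases "t = 0") (auto simp: bump_def)
  have B1: "B t = B 1" if "1 \<le> t" for t
    using MVT[of 1 t] that by (cases "t = 1") (auto simp: bump_def)
  have pos: "0 < B 1 - B 0" using MVT[of 0 1] by (auto simp: bump_def exp_gt_zero simp del: diff_gt_0_iff_gt)
  show thesis
  proof (rule that[of "\<lambda>t. (B t - B 0) / (B 1 - B 0)" "1 / (B 1 - B 0)"])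
    show "((\<lambda>t. (B t - B 0) / (B 1 - B 0)) has_real_derivative 1 / (B 1 - B 0) * ?\<beta> t) (at t)" for t
      using pos by (auto intro!: derivative_eq_intros B)
    show "t \<le> 0 \<Longrightarrow> (B t - B 0) / (B 1 - B 0) = 0" for t using B0[of t] by simp
    show "1 \<le> t \<Longrightarrow> (B t - B 0) / (B 1 - B 0) = 1" for t using B1[of t] pos by simp
  qed (use pos in auto)
qed

section \<open>From the distributional derivative to an integral identity\<close>

lemma DERIV_rescale:
  assumes "\<And>t. (S has_real_derivative \<rho> t) (at t)"
  shows "((\<lambda>t. S ((t - c) / \<epsilon>)) has_real_derivative \<rho> ((t - c) / \<epsilon>) / \<epsilon>) (at t within A)"
proof -
  have "((\<lambda>t. (t - c) / \<epsilon>) has_real_derivative 1 / \<epsilon>) (at t within A)"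
    by (rule DERIV_cdivide[OF DERIV_diff[OF DERIV_ident DERIV_const], simplified])
  from DERIV_chain2[OF assms this] show ?thesis by simp
qed

text \<open>The rescaled \<open>\<rho>\<close> is a probability density supported in
  \<open>[c, c + \<epsilon>]\<close>, so integrating \<open>G\<close> against it averages values
  within \<open>\<delta>\<close> of \<open>G c\<close>.\<close>

lemma integral_against_step_derivative:
  fixes G S \<rho> :: "real \<Rightarrow> real"
  assumes S: "\<And>t. (S has_real_derivative \<rho> t) (at t)" and \<rho>: "\<And>t. 0 \<le> \<rho> t" "continuous_on UNIV \<rho>"
    and S0: "\<And>t. t \<le> 0 \<Longrightarrow> S t = 0" and S1: "\<And>t. 1 \<le> t \<Longrightarrow> S t = 1"
    and \<rho>0: "\<And>t. t \<notin> {0..1} \<Longrightarrow> \<rho> t = 0"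
    and \<epsilon>: "0 < \<epsilon>" and c: "a \<le> c" "c + \<epsilon> \<le> d"
    and G: "continuous_on {a..d} G" and osc: "\<And>t. t \<in> {c..c + \<epsilon>} \<Longrightarrow> \<bar>G t - G c\<bar> \<le> \<delta>"
  shows "\<bar>integral {a..d} (\<lambda>t. G t * (\<rho> ((t - c) / \<epsilon>) / \<epsilon>)) - G c\<bar> \<le> \<delta>"
proof -
  let ?r = "\<lambda>t. \<rho> ((t - c) / \<epsilon>) / \<epsilon>"
  have cr: "continuous_on A ?r" for A
    using \<epsilon> by (intro continuous_intros continuous_on_compose2[OF \<rho>(2)]) auto
  have "(?r has_integral S ((d - c) / \<epsilon>) - S ((a - c) / \<epsilon>)) {a..d}"
  proof (rule fundamental_theorem_of_calculus)
    show "((\<lambda>t. S ((t - c) / \<epsilon>)) has_vector_derivative ?r t) (at t within {a..d})" for t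
      unfolding has_real_derivative_iff_has_vector_derivative[symmetric]
      by (rule DERIV_rescale[OF S])
  qed (use \<epsilon> c in auto)
  moreover have "S ((d - c) / \<epsilon>) = 1" using \<epsilon> c by (intro S1) (simp add: le_divide_eq)
  moreover have "S ((a - c) / \<epsilon>) = 0" using \<epsilon> c by (intro S0) (simp add: divide_le_eq)
  ultimately have I: "(?r has_integral 1) {a..d}" by simp
  have i1: "(\<lambda>t. G t * ?r t) integrable_on {a..d}"
    by (intro integrable_continuous_real continuous_intros G cr)
  have "integral {a..d} (\<lambda>t. G t * ?r t) - G c = integral {a..d} (\<lambda>t. G t * ?r t - G c * ?r t)"
    using has_integral_mult_right[OF I, of "G c"] i1
    by (subst integral_diff) (auto simp: has_integral_iff)
  also have "norm \<dots> \<le> integral {a..d} (\<lambda>t. \<delta> * ?r t)"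
  proof (rule integral_norm_bound_integral)
    show "(\<lambda>t. G t * ?r t - G c * ?r t) integrable_on {a..d}"
      by (intro integrable_continuous_real continuous_intros G cr)
    show "(\<lambda>t. \<delta> * ?r t) integrable_on {a..d}"
      by (intro integrable_continuous_real continuous_intros cr)
    fix t
    show "norm (G t * ?r t - G c * ?r t) \<le> \<delta> * ?r t"
    proof (cases "t \<in> {c..c + \<epsilon>}")
      case True
      have "norm (G t * ?r t - G c * ?r t) = \<bar>G t - G c\<bar> * ?r t"
        using \<epsilon> \<rho>(1) by (simp only: left_diff_distrib[symmetric] real_norm_def abs_mult) simp
      also have "\<dots> \<le> \<delta> * ?r t" using osc[OF True] \<epsilon> \<rho>(1) by (intro mult_right_mono) auto
      finally show ?thesis .
    next
      case False
      then have "\<rho> ((t - c) / \<epsilon>) = 0" using \<epsilon> by (intro \<rho>0) (auto simp: divide_le_eq le_divide_eq)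
      then show ?thesis by simp
    qed
  qed
  also have "\<dots> = \<delta>" using has_integral_mult_right[OF I, of \<delta>] by (simp add: has_integral_iff)
  finally show ?thesis by simp
qed

lemma LINT_Ioi_eq_integral:
  fixes F :: "real \<Rightarrow> real"
  assumes "0 < a" "continuous_on {a..d} F" "\<And>t. t \<notin> {a..d} \<Longrightarrow> F t = 0"
  shows "(LINT t:{0<..}|lborel. F t) = integral {a..d} F"
proof -
  have "(LINT t:{0<..}|lborel. F t) = (LINT t:{a..d}|lborel. F t)"
    unfolding set_lebesgue_integral_def
    using assms(1,3) by (intro Bochner_Integration.integral_cong refl) (auto simp: indicator_def)
  also have "\<dots> = integral {a..d} F"
    by (rule set_borel_integral_eq_integral borel_integrable_atLeastAtMost' assms)+
  finally show ?thesis .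
qed

text \<open>Testing with a smoothed indicator of \<open>[a, b]\<close> shows that \<open>g - \<integral> h\<close> takes the same value at
  \<open>a\<close> and \<open>b\<close>.\<close>

lemma distributional_derivative_eq_pos:
  assumes g: "continuous_on {0..} g" and h: "continuous_on {0..} h"
    and dist: "has_distributional_derivative g h" and ab: "0 < a" "a < b"
  shows "g a - integral {0..a} h = g b - integral {0..b} h"
proof -
  define H where "H t = integral {0..t} h" for t
  define G where "G t = g t - H t" for t
  have dH: "(H has_real_derivative h t) (at t within {0..d})" if "t \<in> {0..d}" for t d
    unfolding H_def by (rule integral_has_real_derivative[OF continuous_on_subset[OF h] that]) auto
  have cH: "continuous_on {0..d} H" for d using dH DERIV_continuous_on by blast
  have cG: "continuous_on {0..d} G" for d
    unfolding G_def by (intro continuous_intros cH continuous_on_subset[OF g]) auto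
  obtain S c0 where S: "\<And>t. (S has_real_derivative c0 * bump 1 0 t) (at t)" "0 \<le> c0"
    and S0: "\<And>t. t \<le> 0 \<Longrightarrow> S t = 0" and S1: "\<And>t. 1 \<le> t \<Longrightarrow> S t = 1" by (rule smooth_step) blast
  define \<rho> where "\<rho> t = c0 * bump 1 0 t" for t
  have S': "(S has_real_derivative \<rho> t) (at t)" for t using S by (simp add: \<rho>_def)
  have \<rho>: "0 \<le> \<rho> t" for t using S(2) by (simp add: \<rho>_def bump_def)
  have \<rho>0: "\<rho> t = 0" if "t \<notin> {0..1}" for t using that by (auto simp: \<rho>_def bump_def)
  have c\<rho>: "continuous_on UNIV \<rho>"
    using bump_has_derivative[of 1 0] unfolding \<rho>_def
    by (intro continuous_intros) (meson DERIV_isCont continuous_at_imp_continuous_on)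
  \<comment> \<open>The distributional identity makes the averages of \<open>G\<close> just after
    \<open>a\<close> and just after \<open>b\<close> equal; each is within \<open>\<delta>\<close>
    of the corresponding point value.\<close>
  have key: "\<bar>G a - G b\<bar> \<le> 2 * \<delta>" if \<delta>: "0 < \<delta>" for \<delta>
  proof -
    have "\<exists>\<epsilon>>0. \<forall>t\<in>{c..c + \<epsilon>}. \<bar>G t - G c\<bar> \<le> \<delta>" if "0 < c" for c
    proof -
      have "continuous_on {0..c + 1} G" by (rule cG)
      then obtain d where d: "d > 0" "\<And>t. t \<in> {0..c + 1} \<Longrightarrow> dist t c < d \<Longrightarrow> dist (G t) (G c) < \<delta>"
        using \<open>0 < c\<close> \<delta> unfolding continuous_on_iff by (metis add_increasing2 atLeastAtMost_iff less_eq_real_def le_add_same_cancel1 zero_le_one)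
      show ?thesis
      proof (intro exI[of _ "min 1 (d / 2)"] conjI ballI)
        fix t assume "t \<in> {c..c + min 1 (d / 2)}"
        then show "\<bar>G t - G c\<bar> \<le> \<delta>"
          using d(1) \<open>0 < c\<close> by (intro less_imp_le d(2)[unfolded dist_real_def]) auto
      qed (use d in auto)
    qed
    then obtain \<epsilon>1 \<epsilon>2 where \<epsilon>1: "\<epsilon>1 > 0" "\<And>t. t\<in>{a..a + \<epsilon>1} \<Longrightarrow> \<bar>G t - G a\<bar> \<le> \<delta>"
      and \<epsilon>2: "\<epsilon>2 > 0" "\<And>t. t\<in>{b..b + \<epsilon>2} \<Longrightarrow> \<bar>G t - G b\<bar> \<le> \<delta>"
      using ab by (meson less_trans)
    define \<epsilon> where "\<epsilon> = min \<epsilon>1 \<epsilon>2"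
    have \<epsilon>: "\<epsilon> > 0" using \<epsilon>1(1) \<epsilon>2(1) by (simp add: \<epsilon>_def)
    define d where "d = b + \<epsilon>"
    \<comment> \<open>Rises on \<open>[a, a + \<epsilon>]\<close> and falls on
      \<open>[b, b + \<epsilon>]\<close>. The two ramps may overlap: only the support in
      \<open>[a, d]\<close> and the form of the derivative matter.\<close>
    define \<psi> where "\<psi> t = S ((t - a) / \<epsilon>) - S ((t - b) / \<epsilon>)" for t
    define \<psi>' where "\<psi>' t = \<rho> ((t - a) / \<epsilon>) / \<epsilon> - \<rho> ((t - b) / \<epsilon>) / \<epsilon>" for t
    have d\<psi>: "(\<psi> has_real_derivative \<psi>' t) (at t)" for t
      unfolding \<psi>_def \<psi>'_def by (intro DERIV_diff DERIV_rescale S')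
    have \<psi>0: "\<psi> t = 0" if "t \<le> a" for t
      using that ab \<epsilon> by (simp add: \<psi>_def S0 divide_le_eq)
    have \<psi>1: "\<psi> t = 0" if "d \<le> t" for t
      using that ab \<epsilon> by (simp add: \<psi>_def S1 le_divide_eq d_def)
    have \<psi>'0: "\<psi>' t = 0" if "t \<notin> {a..d}" for t
    proof -
      have "(t - a) / \<epsilon> \<notin> {0..1}" "(t - b) / \<epsilon> \<notin> {0..1}"
        using that ab \<epsilon> by (auto simp: d_def divide_le_eq le_divide_eq)
      then show ?thesis using \<rho>0 by (simp add: \<psi>'_def)
    qed
    have deriv\<psi>: "deriv \<psi> = \<psi>'" by (rule ext) (rule DERIV_imp_deriv[OF d\<psi>])
    have test: "test_function \<psi>"
      unfolding test_function_def
    proof (intro conjI allI exI)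
      \<comment> \<open>\<open>\<psi>\<close> is an antiderivative of bumps and not itself a bump
        combination, so it is inserted by hand; from its first derivative on, the class is
        closed.\<close>
      define A where "A = insert \<psi> {F. \<exists>c1 c2 P n Q k. F = (\<lambda>t.
          c1 * bump P n (1 / \<epsilon> * t + - a / \<epsilon>) - c2 * bump Q k (1 / \<epsilon> * t + - b / \<epsilon>))}"
      have "\<psi>' = (\<lambda>t. (c0 / \<epsilon>) * bump 1 0 (1 / \<epsilon> * t + - a / \<epsilon>) - (c0 / \<epsilon>) * bump 1 0 (1 / \<epsilon> * t + - b / \<epsilon>))"
        by (rule ext) (simp add: \<psi>'_def \<rho>_def diff_divide_distrib)
      then have "\<psi>' \<in> A" unfolding A_def by blast
      show "(deriv ^^ k) \<psi> differentiable_on UNIV" for k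
      proof (rule deriv_funpow_differentiable[where A = A])
        show "\<psi> \<in> A" by (simp add: A_def)
        fix F assume "F \<in> A"
        then consider "F = \<psi>" | c1 c2 P n Q k where "F = (\<lambda>t.
          c1 * bump P n (1 / \<epsilon> * t + - a / \<epsilon>) - c2 * bump Q k (1 / \<epsilon> * t + - b / \<epsilon>))"
          unfolding A_def by blast
        then show "\<exists>F'\<in>A. \<forall>t. (F has_real_derivative F' t) (at t)"
        proof cases
          case 1 then show ?thesis using d\<psi> \<open>\<psi>' \<in> A\<close> by blast
        next
          case 2
          obtain c1' c2' P' n' Q' k' where "\<And>t. (F has_real_derivative
              c1' * bump P' n' (1 / \<epsilon> * t + - a / \<epsilon>) - c2' * bump Q' k' (1 / \<epsilon> * t + - b / \<epsilon>)) (at t)"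
            using has_real_derivative_bump_combination[of c1 P n "1 / \<epsilon>" "- a / \<epsilon>" c2 Q k "- b / \<epsilon>"]
            unfolding 2 by blast
          moreover have "(\<lambda>t. c1' * bump P' n' (1 / \<epsilon> * t + - a / \<epsilon>) - c2' * bump Q' k' (1 / \<epsilon> * t + - b / \<epsilon>)) \<in> A"
            unfolding A_def by blast
          ultimately show ?thesis by (intro bexI allI)
        qed
      qed
      show "0 < a" by (rule ab)
      show "t \<notin> {a..d} \<longrightarrow> \<psi> t = 0" for t using \<psi>0[of t] \<psi>1[of t] by auto
    qed
    have sub: "{a..d} \<subseteq> {0..d}" "{a..d} \<subseteq> {0..}" using ab by auto
    have c\<psi>: "continuous_on {a..d} \<psi>" using d\<psi> DERIV_isCont continuous_at_imp_continuous_on by blast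
    have cr: "continuous_on {a..d} (\<lambda>t. \<rho> ((t - c) / \<epsilon>) / \<epsilon>)" for c
      using \<epsilon> by (intro continuous_intros continuous_on_compose2[OF c\<rho>]) auto
    have c\<psi>': "continuous_on {a..d} \<psi>'" unfolding \<psi>'_def by (intro continuous_intros cr)
    have "- integral {a..d} (\<lambda>t. g t * \<psi>' t) = integral {a..d} (\<lambda>t. h t * \<psi> t)"
    proof -
      have "(LINT t:{0<..}|lborel. g t * \<psi>' t) = integral {a..d} (\<lambda>t. g t * \<psi>' t)"
        by (rule LINT_Ioi_eq_integral[OF ab(1)])
          (auto intro!: continuous_intros c\<psi>' continuous_on_subset[OF g sub(2)] simp: \<psi>'0)
      moreover have "(LINT t:{0<..}|lborel. h t * \<psi> t) = integral {a..d} (\<lambda>t. h t * \<psi> t)"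
        by (rule LINT_Ioi_eq_integral[OF ab(1)])
          (use \<psi>0 \<psi>1 in \<open>auto intro!: continuous_intros c\<psi> continuous_on_subset[OF h sub(2)]\<close>)
      ultimately show ?thesis
        using dist test unfolding has_distributional_derivative_def by (metis deriv\<psi>)
    qed
    \<comment> \<open>Integration by parts; the boundary terms vanish because \<open>\<psi>\<close>
      is zero at \<open>a\<close> and \<open>d\<close>. Together with the preceding identity,
      \<open>G = g - H\<close> integrates to zero against \<open>\<psi>'\<close>.\<close>
    moreover have "integral {a..d} (\<lambda>t. h t * \<psi> t) = - integral {a..d} (\<lambda>t. H t * \<psi>' t)"
    proof -
      have "((\<lambda>t. h t * \<psi> t + \<psi>' t * H t) has_integral H d * \<psi> d - H a * \<psi> a) {a..d}"
      proof (rule fundamental_theorem_of_calculus)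
        fix t assume t: "t \<in> {a..d}"
        show "((\<lambda>t. H t * \<psi> t) has_vector_derivative h t * \<psi> t + \<psi>' t * H t) (at t within {a..d})"
          unfolding has_real_derivative_iff_has_vector_derivative[symmetric]
          using t sub(1) by (intro DERIV_mult DERIV_subset[OF dH] has_field_derivative_at_within[OF d\<psi>]) auto
      qed (use ab \<epsilon> in \<open>simp add: d_def\<close>)
      then have "integral {a..d} (\<lambda>t. h t * \<psi> t + H t * \<psi>' t) = 0"
        using \<psi>0[of a] \<psi>1[of d] by (simp add: has_integral_iff mult.commute)
      moreover have "integral {a..d} (\<lambda>t. h t * \<psi> t + H t * \<psi>' t)
          = integral {a..d} (\<lambda>t. h t * \<psi> t) + integral {a..d} (\<lambda>t. H t * \<psi>' t)"
        by (intro Henstock_Kurzweil_Integration.integral_add integrable_continuous_real continuous_intros c\<psi> c\<psi>'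
            continuous_on_subset[OF h sub(2)] continuous_on_subset[OF cH sub(1)])
      ultimately show ?thesis by simp
    qed
    moreover have "integral {a..d} (\<lambda>t. G t * \<psi>' t)
        = integral {a..d} (\<lambda>t. g t * \<psi>' t) - integral {a..d} (\<lambda>t. H t * \<psi>' t)"
      unfolding G_def left_diff_distrib
      by (intro Henstock_Kurzweil_Integration.integral_diff integrable_continuous_real continuous_intros c\<psi>'
            continuous_on_subset[OF g sub(2)] continuous_on_subset[OF cH sub(1)])
    moreover have "integral {a..d} (\<lambda>t. G t * \<psi>' t) =
        integral {a..d} (\<lambda>t. G t * (\<rho> ((t - a) / \<epsilon>) / \<epsilon>)) - integral {a..d} (\<lambda>t. G t * (\<rho> ((t - b) / \<epsilon>) / \<epsilon>))"
      unfolding \<psi>'_def right_diff_distrib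
      by (intro Henstock_Kurzweil_Integration.integral_diff integrable_continuous_real continuous_on_mult cr
            continuous_on_subset[OF cG sub(1)])
    moreover have "\<bar>integral {a..d} (\<lambda>t. G t * (\<rho> ((t - a) / \<epsilon>) / \<epsilon>)) - G a\<bar> \<le> \<delta>"
      by (rule integral_against_step_derivative[OF S' \<rho> c\<rho> S0 S1 \<rho>0 \<epsilon>])
        (use ab \<epsilon> \<epsilon>1 continuous_on_subset[OF cG sub(1)] in \<open>auto simp: d_def \<epsilon>_def\<close>)
    moreover have "\<bar>integral {a..d} (\<lambda>t. G t * (\<rho> ((t - b) / \<epsilon>) / \<epsilon>)) - G b\<bar> \<le> \<delta>"
      by (rule integral_against_step_derivative[OF S' \<rho> c\<rho> S0 S1 \<rho>0 \<epsilon>])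
        (use ab \<epsilon> \<epsilon>2 continuous_on_subset[OF cG sub(1)] in \<open>auto simp: d_def \<epsilon>_def\<close>)
    ultimately show ?thesis by linarith
  qed
  have "\<bar>G a - G b\<bar> \<le> 0"
  proof (rule field_le_epsilon)
    fix e :: real assume "0 < e"
    then show "\<bar>G a - G b\<bar> \<le> 0 + e" using key[of "e / 2"] by simp
  qed
  then show ?thesis by (simp add: G_def H_def)
qed

text \<open>Test functions do not see time 0, so constancy of \<open>g - \<integral> h\<close> is
  known only for positive times; continuity carries it to 0. Working up to \<open>T + 1\<close>
  keeps the interval nondegenerate when \<open>T = 0\<close>.\<close>

lemma distributional_derivative_imp_integral:
  assumes g: "continuous_on {0..} g" and h: "continuous_on {0..} h"
    and dist: "has_distributional_derivative g h" and T: "0 \<le> T"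
  shows "g T - g 0 = integral {0..T} h"
proof -
  define G where "G t = g t - integral {0..t} h" for t
  have "continuous_on {0..T + 1} (\<lambda>t. integral {0..t} h)"
    by (intro indefinite_integral_continuous_1 integrable_continuous_real continuous_on_subset[OF h]) auto
  then have cG: "continuous_on {0..T + 1} G"
    unfolding G_def by (intro continuous_intros continuous_on_subset[OF g]) auto
  have eq: "G t = G (T + 1)" if "t \<in> {0<..<T + 1}" for t
    using distributional_derivative_eq_pos[OF g h dist, of t "T + 1"] that by (simp add: G_def)
  have "closure {0<..<T + 1} = {0..T + 1}" using T by simp
  then have "G t = G (T + 1)" if "t \<in> {0..T + 1}" for t
    using continuous_constant_on_closure[of "{0<..<T + 1}" G "G (T + 1)" t] cG eq that by simp
  from this[of 0] this[of T] T show ?thesis by (simp add: G_def)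
qed

section \<open>A discrete Caccioppoli estimate\<close>

text \<open>Summation by parts on a set \<open>A\<close> that is not translation invariant:
  \<open>A\<close> contains the support of \<open>v\<close> and its translate, so the shift only
  gains or loses zero terms.\<close>

lemma sum_lattice_shift:
  fixes v F :: "int ^ 'n \<Rightarrow> real"
  assumes "finite A" and "\<And>\<alpha>. v \<alpha> \<noteq> 0 \<Longrightarrow> \<alpha> \<in> A" and "\<And>\<alpha>. v (\<alpha> + \<epsilon>) \<noteq> 0 \<Longrightarrow> \<alpha> \<in> A"
  shows "(\<Sum>\<alpha>\<in>A. v \<alpha> * F (\<alpha> - \<epsilon>)) = (\<Sum>\<alpha>\<in>A. v (\<alpha> + \<epsilon>) * F \<alpha>)"
  by (rule sum.reindex_bij_witness_not_neutral
        [where S' = "{\<alpha>\<in>A. v \<alpha> = 0}" and T' = "{\<alpha>\<in>A. v (\<alpha> + \<epsilon>) = 0}"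
          and i = "\<lambda>\<alpha>. \<alpha> + \<epsilon>" and j = "\<lambda>\<alpha>. \<alpha> - \<epsilon>"])
    (use assms in auto)

text \<open>The bound is independent of the supremum of \<open>D\<close>: boundedness only ensures that the supremum
  can be absorbed.\<close>

lemma dissipation_le:
  fixes D :: "int ^ 'n \<Rightarrow> real" and F :: "int ^ 'n \<Rightarrow> real ^ 'n"
  assumes dim: "CARD('n) \<le> 2" and b: "0 \<le> b"
    and D0: "\<And>\<alpha>. 0 \<le> D \<alpha>" and bdd: "bdd_above (range D)"
    and F: "\<And>\<alpha> j. (F \<alpha> $ j)\<^sup>2 \<le> b * D \<alpha>"
    and div: "\<And>\<alpha>. D \<alpha> \<le> \<eta> + lattice_div F \<alpha>"
  shows "D \<alpha> \<le> 2 * \<eta> + 16 * b"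
proof -
  define m where "m = (SUP \<alpha>. D \<alpha>)"
  have Dm: "D \<beta> \<le> m" for \<beta> unfolding m_def by (rule cSUP_upper[OF _ bdd]) simp
  \<comment> \<open>AM-GM with weights such that \<open>4 * (m / 8) * (2 * b) = b * m\<close>. A
    site meets at most four such fluxes, two per direction, so they cost at most
    \<open>m / 2\<close>.\<close>
  have Fm: "\<bar>F \<beta> $ j\<bar> \<le> m / 8 + 2 * b" for \<beta> j
  proof (rule power2_le_imp_le)
    have "\<bar>F \<beta> $ j\<bar>\<^sup>2 \<le> b * m" using F[of \<beta> j] mult_left_mono[OF Dm[of \<beta>] b] by simp
    also have "\<dots> \<le> (m / 8 + 2 * b)\<^sup>2"
      using zero_le_power2[of "m / 8 - 2 * b"] by (simp add: power2_eq_square algebra_simps)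
    finally show "\<bar>F \<beta> $ j\<bar>\<^sup>2 \<le> (m / 8 + 2 * b)\<^sup>2" .
    show "0 \<le> m / 8 + 2 * b" using b Dm[of \<beta>] D0[of \<beta>] by simp
  qed
  have m0: "0 \<le> m" using Dm[of \<alpha>] D0[of \<alpha>] by simp
  have "D \<beta> \<le> \<eta> + m / 2 + 8 * b" for \<beta>
  proof -
    have "lattice_div F \<beta> \<le> (\<Sum>j\<in>(UNIV::'n set). 2 * (m / 8 + 2 * b))"
      unfolding lattice_div_def
    proof (rule sum_mono)
      fix j show "F \<beta> $ j - F (\<beta> - axis j 1) $ j \<le> 2 * (m / 8 + 2 * b)"
        using abs_le_D1[OF Fm[of \<beta> j]] abs_le_D2[OF Fm[of "\<beta> - axis j 1" j]] by argo
    qed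
    also have "\<dots> = real CARD('n) * (2 * (m / 8 + 2 * b))" by simp
    also have "\<dots> \<le> 2 * (2 * (m / 8 + 2 * b))"
      using dim b m0 by (intro mult_right_mono) auto
    finally show ?thesis using div[of \<beta>] by simp
  qed
  \<comment> \<open>Taking the supremum over sites and absorbing \<open>m / 2\<close> on the left
    doubles the remaining terms.\<close>
  then have "m \<le> \<eta> + m / 2 + 8 * b" unfolding m_def by (intro cSUP_least) auto
  then show ?thesis using Dm[of \<alpha>] by linarith
qed

text \<open>With \<open>\<delta> = v - w\<close>, \<open>w\<^sup>2 - v\<^sup>2\<close> equals
  \<open>- 2 * w * \<delta> - \<delta>\<^sup>2\<close>. The first term is split by AM-GM, with a
  quarter of \<open>w\<^sup>2 * D\<close> and \<open>4 * b * \<delta>\<^sup>2\<close>. The second,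
  which is specific to the discrete setting, has no factor \<open>w\<close> to absorb it; it uses
  \<open>\<bar>x\<bar> \<le> b + M\<close>, whence \<open>5 * b + M\<close>.\<close>

lemma cutoff_flux_le:
  fixes w v x D M b :: real
  assumes "0 \<le> w" "0 \<le> b" "0 \<le> D" "D \<le> M" "x\<^sup>2 \<le> b * D"
  shows "x * (w\<^sup>2 - v\<^sup>2) \<le> w\<^sup>2 * D / 4 + (5 * b + M) * (v - w)\<^sup>2"
proof -
  define \<delta> where "\<delta> = v - w"
  have "x\<^sup>2 \<le> b * M" using assms(5) mult_left_mono[OF assms(4,2)] by simp
  also have "\<dots> \<le> (b + M)\<^sup>2" using assms by (simp add: power2_eq_square algebra_simps)
  finally have xM: "\<bar>x\<bar> \<le> b + M" using assms by (simp add: abs_le_square_iff[symmetric])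
  have "\<bar>x\<bar> \<le> sqrt b * sqrt D"
    using assms(5) by (metis real_sqrt_abs real_sqrt_le_iff real_sqrt_mult)
  then have "2 * \<bar>x\<bar> * (w * \<bar>\<delta>\<bar>) \<le> 2 * (sqrt b * sqrt D) * (w * \<bar>\<delta>\<bar>)"
    using assms(1) by (intro mult_right_mono) auto
  also have "\<dots> \<le> (w * sqrt D)\<^sup>2 / 4 + 4 * (sqrt b * \<bar>\<delta>\<bar>)\<^sup>2"
    using zero_le_power2[of "w * sqrt D / 2 - 2 * (sqrt b * \<bar>\<delta>\<bar>)"]
    by (simp add: power2_diff power_mult_distrib power_divide algebra_simps)
  also have "\<dots> = w\<^sup>2 * D / 4 + 4 * b * \<delta>\<^sup>2" using assms by (simp add: power_mult_distrib)
  finally have 1: "2 * \<bar>x\<bar> * (w * \<bar>\<delta>\<bar>) \<le> w\<^sup>2 * D / 4 + 4 * b * \<delta>\<^sup>2" .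
  have "x * (w\<^sup>2 - v\<^sup>2) = - (2 * x * (w * \<delta>)) - x * \<delta>\<^sup>2"
    by (simp add: \<delta>_def power2_eq_square algebra_simps)
  also have "\<dots> \<le> 2 * \<bar>x\<bar> * (w * \<bar>\<delta>\<bar>) + \<bar>x\<bar> * \<delta>\<^sup>2"
  proof (rule order_trans[OF abs_ge_self order_trans[OF abs_triangle_ineq4]])
    show "\<bar>- (2 * x * (w * \<delta>))\<bar> + \<bar>x * \<delta>\<^sup>2\<bar> \<le> 2 * \<bar>x\<bar> * (w * \<bar>\<delta>\<bar>) + \<bar>x\<bar> * \<delta>\<^sup>2"
      using assms(1) by (simp add: abs_mult)
  qed
  also have "\<bar>x\<bar> * \<delta>\<^sup>2 \<le> (b + M) * \<delta>\<^sup>2" using xM by (intro mult_right_mono) auto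
  finally show ?thesis using 1 by (simp add: \<delta>_def algebra_simps)
qed

text \<open>Multiplying the averaged balance by \<open>w\<^sup>2\<close> and shifting the sum moves
  the difference from \<open>F\<close> to \<open>w\<^sup>2\<close>, where
  \<open>cutoff_flux_le\<close> applies bond by bond.\<close>

lemma cutoff_dissipation_le:
  fixes D w :: "int ^ 'n \<Rightarrow> real" and F :: "int ^ 'n \<Rightarrow> real ^ 'n"
  assumes dim: "CARD('n) \<le> 2" and b: "0 \<le> b"
    and D0: "\<And>\<alpha>. 0 \<le> D \<alpha>" and DM: "\<And>\<alpha>. D \<alpha> \<le> M"
    and F: "\<And>\<alpha> j. (F \<alpha> $ j)\<^sup>2 \<le> b * D \<alpha>"
    and div: "\<And>\<alpha>. D \<alpha> \<le> \<eta> + lattice_div F \<alpha>"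
    and A: "finite A" "\<And>\<alpha>. w \<alpha> \<noteq> 0 \<Longrightarrow> \<alpha> \<in> A" "\<And>\<alpha> j. w (\<alpha> + axis j 1) \<noteq> 0 \<Longrightarrow> \<alpha> \<in> A"
    and w0: "\<And>\<alpha>. 0 \<le> w \<alpha>"
  shows "(\<Sum>\<alpha>\<in>A. (w \<alpha>)\<^sup>2 * D \<alpha>) \<le> 2 * \<eta> * (\<Sum>\<alpha>\<in>A. (w \<alpha>)\<^sup>2)
     + 2 * (5 * b + M) * (\<Sum>j\<in>UNIV. \<Sum>\<alpha>\<in>A. (w (\<alpha> + axis j 1) - w \<alpha>)\<^sup>2)"
proof -
  let ?S = "\<Sum>\<alpha>\<in>A. (w \<alpha>)\<^sup>2 * D \<alpha>"
  have S0: "0 \<le> ?S" by (intro sum_nonneg) (simp add: D0)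
  have "?S \<le> (\<Sum>\<alpha>\<in>A. (w \<alpha>)\<^sup>2 * (\<eta> + lattice_div F \<alpha>))"
    by (intro sum_mono mult_left_mono div) auto
  also have "\<dots> = \<eta> * (\<Sum>\<alpha>\<in>A. (w \<alpha>)\<^sup>2) + (\<Sum>j\<in>UNIV. \<Sum>\<alpha>\<in>A. (w \<alpha>)\<^sup>2 * (F \<alpha> $ j - F (\<alpha> - axis j 1) $ j))"
    unfolding lattice_div_def
    by (subst sum.swap) (simp add: distrib_left sum.distrib sum_distrib_left mult.commute)
  also have "(\<Sum>j\<in>UNIV. \<Sum>\<alpha>\<in>A. (w \<alpha>)\<^sup>2 * (F \<alpha> $ j - F (\<alpha> - axis j 1) $ j))
      = (\<Sum>j\<in>UNIV. \<Sum>\<alpha>\<in>A. F \<alpha> $ j * ((w \<alpha>)\<^sup>2 - (w (\<alpha> + axis j 1))\<^sup>2))"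
  proof (rule sum.cong[OF refl])
    fix j :: 'n
    have "(\<Sum>\<alpha>\<in>A. (w \<alpha>)\<^sup>2 * F (\<alpha> - axis j 1) $ j) = (\<Sum>\<alpha>\<in>A. (w (\<alpha> + axis j 1))\<^sup>2 * F \<alpha> $ j)"
      by (rule sum_lattice_shift[where v = "\<lambda>\<alpha>. (w \<alpha>)\<^sup>2" and F = "\<lambda>\<alpha>. F \<alpha> $ j"]) (use A in auto)
    then show "(\<Sum>\<alpha>\<in>A. (w \<alpha>)\<^sup>2 * (F \<alpha> $ j - F (\<alpha> - axis j 1) $ j))
        = (\<Sum>\<alpha>\<in>A. F \<alpha> $ j * ((w \<alpha>)\<^sup>2 - (w (\<alpha> + axis j 1))\<^sup>2))"
      by (simp add: right_diff_distrib sum_subtractf mult.commute)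
  qed
  also have "\<dots> \<le> (\<Sum>j\<in>(UNIV::'n set). \<Sum>\<alpha>\<in>A.
      (w \<alpha>)\<^sup>2 * D \<alpha> / 4 + (5 * b + M) * (w (\<alpha> + axis j 1) - w \<alpha>)\<^sup>2)"
    by (intro sum_mono cutoff_flux_le w0 b D0 DM F)
  also have "\<dots> = real CARD('n) * (?S / 4)
      + (5 * b + M) * (\<Sum>j\<in>UNIV. \<Sum>\<alpha>\<in>A. (w (\<alpha> + axis j 1) - w \<alpha>)\<^sup>2)"
    by (simp add: sum.distrib sum_distrib_left sum_divide_distrib)
  \<comment> \<open>At most two directions, each costing a quarter of \<open>?S\<close>: half of
    \<open>?S\<close> survives on the left, which explains the factors 2 in the conclusion.\<close>
  also have "real CARD('n) * (?S / 4) \<le> 2 * (?S / 4)"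
    using dim S0 by (intro mult_right_mono) auto
  finally show ?thesis by (simp add: algebra_simps)
qed

section \<open>Boxes and logarithmic cutoffs on the lattice\<close>

definition lattice_radius :: "int ^ 'n \<Rightarrow> nat" where
  "lattice_radius \<alpha> = (MAX i. nat \<bar>\<alpha> $ i\<bar>)"

definition lattice_box :: "nat \<Rightarrow> (int ^ 'n) set" where
  "lattice_box r = {\<alpha>. lattice_radius \<alpha> \<le> r}"

lemma lattice_radius_le_iff: "lattice_radius \<alpha> \<le> r \<longleftrightarrow> (\<forall>i. \<bar>\<alpha> $ i\<bar> \<le> int r)"
  unfolding lattice_radius_def by (subst Max_le_iff) (auto simp: nat_le_iff)

lemma lattice_radius_zero [simp]: "lattice_radius 0 = 0"
  using lattice_radius_le_iff[of 0 0] by simp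

lemma lattice_radius_add_axis: "lattice_radius (\<alpha> + axis j 1) \<le> lattice_radius \<alpha> + 1"
proof -
  have *: "\<bar>\<alpha> $ i\<bar> \<le> int (lattice_radius \<alpha>)" for i
    using lattice_radius_le_iff[of \<alpha> "lattice_radius \<alpha>"] by simp
  show ?thesis
  proof (subst lattice_radius_le_iff, rule allI)
    fix i show "\<bar>(\<alpha> + axis j 1) $ i\<bar> \<le> int (lattice_radius \<alpha> + 1)"
      using *[of i] by (auto simp: axis_def)
  qed
qed

lemma lattice_radius_le_add_axis: "lattice_radius \<alpha> \<le> lattice_radius (\<alpha> + axis j 1) + 1"
proof -
  have *: "\<bar>(\<alpha> + axis j 1) $ i\<bar> \<le> int (lattice_radius (\<alpha> + axis j 1))" for i
    using lattice_radius_le_iff[of "\<alpha> + axis j 1" "lattice_radius (\<alpha> + axis j 1)"] by simp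
  show ?thesis
  proof (subst lattice_radius_le_iff, rule allI)
    fix i show "\<bar>\<alpha> $ i\<bar> \<le> int (lattice_radius (\<alpha> + axis j 1) + 1)"
      using *[of i] by (auto simp: axis_def split: if_splits)
  qed
qed

lemma
  shows finite_lattice_box: "finite (lattice_box r :: (int ^ 'n) set)"
    and card_lattice_box: "card (lattice_box r :: (int ^ 'n) set) = (2 * r + 1) ^ CARD('n)"
proof -
  have b: "bij_betw vec_nth (lattice_box r :: (int ^ 'n) set) (PiE UNIV (\<lambda>_. {- int r..int r}))"
    by (rule bij_betwI[where g = vec_lambda])
      (auto simp: lattice_box_def lattice_radius_le_iff abs_le_iff PiE_def Pi_def minus_le_iff)
  show "finite (lattice_box r :: (int ^ 'n) set)"
    using bij_betw_finite[OF b] by (simp add: finite_PiE)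
  have "card (lattice_box r :: (int ^ 'n) set) = (\<Prod>i\<in>(UNIV::'n set). card {- int r..int r})"
    using bij_betw_same_card[OF b] by (simp add: card_PiE del: card_atLeastAtMost_int)
  then show "card (lattice_box r :: (int ^ 'n) set) = (2 * r + 1) ^ CARD('n)"
    by (simp add: nat_mult_distrib nat_add_distrib)
qed

text \<open>The shell of radius \<open>R + 1\<close> has at most \<open>8 * (R + 1)\<close> points
  in dimensions 1 and 2, each of weight \<open>1 / (R + 2)\<^sup>2\<close>, so it adds at most
  \<open>8 / (R + 2)\<close>. In higher dimension the shells grow too fast for logarithmic
  growth.\<close>

lemma sum_radius_le_harm:
  assumes dim: "CARD('n) \<le> 2"
  shows "(\<Sum>\<alpha>\<in>(lattice_box R :: (int ^ 'n) set). 1 / (real (lattice_radius \<alpha>) + 1)\<^sup>2) \<le> 8 * harm (R + 1)"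
proof (induction R)
  case 0
  have "lattice_box 0 = {0 :: int ^ 'n}"
    by (auto simp: lattice_box_def lattice_radius_le_iff vec_eq_iff simp del: le_zero_eq)
  then show ?case by (simp add: harm_def)
next
  case (Suc R)
  let ?B = "lattice_box :: nat \<Rightarrow> (int ^ 'n) set"
  let ?g = "\<lambda>\<alpha>::int ^ 'n. 1 / (real (lattice_radius \<alpha>) + 1)\<^sup>2"
  have sub: "?B R \<subseteq> ?B (Suc R)" by (auto simp: lattice_box_def)
  have "(2 * Suc R + 1) ^ CARD('n) - (2 * R + 1) ^ CARD('n) \<le> 8 * (R + 1)"
  proof -
    have "CARD('n) = 1 \<or> CARD('n) = 2" using dim zero_less_card_finite[where 'a='n] by linarith
    then show ?thesis by (auto simp: power2_eq_square)
  qed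
  then have card: "card (?B (Suc R) - ?B R) \<le> 8 * (R + 1)"
    by (simp add: card_Diff_subset[OF finite_lattice_box sub] card_lattice_box)
  have "sum ?g (?B (Suc R)) = sum ?g (?B R) + sum ?g (?B (Suc R) - ?B R)"
    using sum.subset_diff[OF sub finite_lattice_box, of ?g] by simp
  also have "sum ?g (?B (Suc R) - ?B R) = (\<Sum>\<alpha>\<in>?B (Suc R) - ?B R. 1 / (real R + 2)\<^sup>2)"
    by (intro sum.cong refl) (auto simp: lattice_box_def le_Suc_eq)
  also have "\<dots> = real (card (?B (Suc R) - ?B R)) * (1 / (real R + 2)\<^sup>2)" by simp
  also have "\<dots> \<le> (8 * (real R + 2)) * (1 / (real R + 2)\<^sup>2)"
    using card by (intro mult_right_mono) auto
  also have "\<dots> = 8 / (real R + 2)" by (simp add: power2_eq_square del: distrib_left_numeral)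
  finally show ?case using Suc by (simp add: harm_Suc inverse_eq_divide add_ac)
qed

text \<open>Harmonic numbers replace the logarithm: their increments are exactly reciprocals, and
  they are indexed by the natural-valued radius. The cutoff is 1 at the origin and 0 from radius
  \<open>R\<close> on.\<close>

definition log_cutoff :: "nat \<Rightarrow> int ^ 'n \<Rightarrow> real" where
  "log_cutoff R \<alpha> = max 0 (1 - harm (lattice_radius \<alpha>) / harm R)"

lemma log_cutoff_supp:
  assumes "R \<ge> 1" "R \<le> lattice_radius \<alpha>" shows "log_cutoff R \<alpha> = 0"
proof -
  have "(0::real) < harm R" using assms by (simp add: harm_pos)
  moreover have "(harm R :: real) \<le> harm (lattice_radius \<alpha>)" using assms by (intro harm_mono)
  ultimately show ?thesis by (simp add: log_cutoff_def)
qed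

text \<open>Truncation at 0 does not increase differences. At radius \<open>r\<close>, an outward
  step changes the harmonic number by \<open>1 / (r + 1)\<close> and an inward step by
  \<open>1 / r\<close>, which is at most \<open>2 / (r + 1)\<close>; the 4 is the square of this
  2.\<close>

lemma log_cutoff_diff:
  assumes R: "R \<ge> 1"
  shows "(log_cutoff R (\<alpha> + axis j 1) - log_cutoff R \<alpha>)\<^sup>2
           \<le> 4 / (harm R)\<^sup>2 * (1 / (real (lattice_radius \<alpha>) + 1)\<^sup>2)"
proof -
  let ?r = "lattice_radius \<alpha>" and ?s = "lattice_radius (\<alpha> + axis j 1)"
  have h: "(0::real) < harm R" using R by (simp add: harm_pos)
  have "?s = ?r \<or> ?s = Suc ?r \<or> ?r = Suc ?s"
    using lattice_radius_add_axis[of \<alpha> j] lattice_radius_le_add_axis[of \<alpha> j] by linarith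
  then have "\<bar>harm ?s - harm ?r\<bar> \<le> 2 / (real ?r + 1)"
    by (elim disjE) (auto simp: harm_Suc inverse_eq_divide field_simps)
  moreover have "\<bar>log_cutoff R (\<alpha> + axis j 1) - log_cutoff R \<alpha>\<bar> \<le> \<bar>harm ?s / harm R - harm ?r / harm R\<bar>"
    unfolding log_cutoff_def by linarith
  moreover have "\<bar>harm ?s / harm R - harm ?r / harm R\<bar> = \<bar>harm ?s - harm ?r\<bar> / (harm R :: real)"
    by (simp add: diff_divide_distrib[symmetric])
  ultimately have "\<bar>log_cutoff R (\<alpha> + axis j 1) - log_cutoff R \<alpha>\<bar> \<le> 2 / (real ?r + 1) / harm R"
    using h by (smt (verit) divide_right_mono)
  then have "\<bar>log_cutoff R (\<alpha> + axis j 1) - log_cutoff R \<alpha>\<bar>\<^sup>2 \<le> (2 / (real ?r + 1) / harm R)\<^sup>2"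
    by (intro power_mono) auto
  then show ?thesis by (simp add: power_divide power_mult_distrib mult.commute)
qed

text \<open>The cutoff is 1 at the origin, so \<open>D 0\<close> is one term of the weighted sum.
  The constant 128 is \<open>2 * 2 * 4 * 8\<close>: absorption, number of directions, squared cutoff
  increment, shell count.\<close>

lemma dissipation_zero_le:
  fixes D :: "int ^ 'n \<Rightarrow> real" and F :: "int ^ 'n \<Rightarrow> real ^ 'n"
  assumes dim: "CARD('n) \<le> 2" and b: "0 \<le> b" and \<eta>: "0 \<le> \<eta>"
    and D0: "\<And>\<alpha>. 0 \<le> D \<alpha>" and DM: "\<And>\<alpha>. D \<alpha> \<le> M"
    and F: "\<And>\<alpha> j. (F \<alpha> $ j)\<^sup>2 \<le> b * D \<alpha>"
    and div: "\<And>\<alpha>. D \<alpha> \<le> \<eta> + lattice_div F \<alpha>"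
    and R: "R \<ge> 1"
  shows "D 0 \<le> 2 * \<eta> * real ((2 * R + 1)\<^sup>2) + 128 * (5 * b + M) * (harm (R + 1) / (harm R)\<^sup>2)"
proof -
  let ?B = "lattice_box R :: (int ^ 'n) set"
  let ?w = "log_cutoff R :: int ^ 'n \<Rightarrow> real"
  have M: "0 \<le> M" using D0[of 0] DM[of 0] by simp
  have h: "(0::real) < harm R" using R by (simp add: harm_pos)
  have w: "0 \<le> ?w \<alpha>" "?w \<alpha> \<le> 1" for \<alpha>
    using h by (auto simp: log_cutoff_def harm_nonneg)
  have fin: "finite ?B" by (rule finite_lattice_box)
  have s1: "\<alpha> \<in> ?B" if "?w \<alpha> \<noteq> 0" for \<alpha>
    using log_cutoff_supp[OF R, of \<alpha>] that by (force simp: lattice_box_def)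
  \<comment> \<open>The cutoff already vanishes at radius \<open>R\<close>, so the box has one spare
    layer for the neighbours of the support.\<close>
  have s2: "\<alpha> \<in> ?B" if "?w (\<alpha> + axis j 1) \<noteq> 0" for \<alpha> j
    using log_cutoff_supp[OF R, of "\<alpha> + axis j 1"] that lattice_radius_le_add_axis[of \<alpha> j]
    by (force simp: lattice_box_def)
  have "D 0 = (?w 0)\<^sup>2 * D 0" by (simp add: log_cutoff_def harm_def)
  also have "\<dots> \<le> (\<Sum>\<alpha>\<in>?B. (?w \<alpha>)\<^sup>2 * D \<alpha>)"
    by (rule member_le_sum[OF _ _ fin]) (auto simp: D0, simp add: lattice_box_def)
  also have "\<dots> \<le> 2 * \<eta> * (\<Sum>\<alpha>\<in>?B. (?w \<alpha>)\<^sup>2)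
     + 2 * (5 * b + M) * (\<Sum>j\<in>UNIV. \<Sum>\<alpha>\<in>?B. (?w (\<alpha> + axis j 1) - ?w \<alpha>)\<^sup>2)"
    by (rule cutoff_dissipation_le[OF dim b D0 DM F div fin s1 s2 w(1)])
  also have "(\<Sum>\<alpha>\<in>?B. (?w \<alpha>)\<^sup>2) \<le> real ((2 * R + 1)\<^sup>2)"
  proof -
    have "(\<Sum>\<alpha>\<in>?B. (?w \<alpha>)\<^sup>2) \<le> (\<Sum>\<alpha>\<in>?B. 1)"
      using w by (intro sum_mono) (simp add: power_le_one)
    also have "\<dots> = real ((2 * R + 1) ^ CARD('n))" by (simp add: card_lattice_box)
    also have "\<dots> \<le> real ((2 * R + 1)\<^sup>2)"
      using dim by (intro of_nat_mono power_increasing) auto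
    finally show ?thesis .
  qed
  also have "(\<Sum>j\<in>(UNIV::'n set). \<Sum>\<alpha>\<in>?B. (?w (\<alpha> + axis j 1) - ?w \<alpha>)\<^sup>2)
      \<le> 2 * (4 / (harm R)\<^sup>2 * (8 * harm (R + 1)))"
  proof -
    have "(\<Sum>\<alpha>\<in>?B. (?w (\<alpha> + axis j 1) - ?w \<alpha>)\<^sup>2) \<le> 4 / (harm R)\<^sup>2 * (8 * harm (R + 1))" for j :: 'n
    proof -
      have "(\<Sum>\<alpha>\<in>?B. (?w (\<alpha> + axis j 1) - ?w \<alpha>)\<^sup>2)
          \<le> (\<Sum>\<alpha>\<in>?B. 4 / (harm R)\<^sup>2 * (1 / (real (lattice_radius \<alpha>) + 1)\<^sup>2))"
        by (intro sum_mono log_cutoff_diff R)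
      also have "\<dots> = 4 / (harm R)\<^sup>2 * (\<Sum>\<alpha>\<in>?B. 1 / (real (lattice_radius \<alpha>) + 1)\<^sup>2)"
        by (simp add: sum_distrib_left)
      also have "\<dots> \<le> 4 / (harm R)\<^sup>2 * (8 * harm (R + 1))"
        by (intro mult_left_mono sum_radius_le_harm dim) auto
      finally show ?thesis .
    qed
    then have "(\<Sum>j\<in>(UNIV::'n set). \<Sum>\<alpha>\<in>?B. (?w (\<alpha> + axis j 1) - ?w \<alpha>)\<^sup>2)
       \<le> (\<Sum>j\<in>(UNIV::'n set). 4 / (harm R)\<^sup>2 * (8 * harm (R + 1)))"
      by (intro sum_mono)
    also have "\<dots> = real CARD('n) * (4 / (harm R)\<^sup>2 * (8 * harm (R + 1)))" by simp
    also have "\<dots> \<le> 2 * (4 / (harm R)\<^sup>2 * (8 * harm (R + 1)))"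
      using dim by (intro mult_right_mono) (auto simp: harm_nonneg)
    finally show ?thesis .
  qed
  finally show ?thesis using \<eta> b M by - (simp add: mult_left_mono, simp add: algebra_simps add_divide_distrib)
qed

text \<open>Translation moves the site to the origin, and \<open>dissipation_le\<close> supplies
  \<open>M = 2 * \<eta> + 16 * b\<close>, turning \<open>5 * b + M\<close> into
  \<open>21 * b + 2 * \<eta>\<close>. No supremum of \<open>D\<close> remains, which matters when
  \<open>D\<close> varies with \<open>T\<close>.\<close>

lemma dissipation_at_le:
  fixes D :: "int ^ 'n \<Rightarrow> real" and F :: "int ^ 'n \<Rightarrow> real ^ 'n"
  assumes dim: "CARD('n) \<le> 2" and b: "0 \<le> b" and \<eta>: "0 \<le> \<eta>"
    and D0: "\<And>\<alpha>. 0 \<le> D \<alpha>" and bdd: "bdd_above (range D)"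
    and F: "\<And>\<alpha> j. (F \<alpha> $ j)\<^sup>2 \<le> b * D \<alpha>"
    and div: "\<And>\<alpha>. D \<alpha> \<le> \<eta> + lattice_div F \<alpha>"
    and R: "R \<ge> 1"
  shows "D \<alpha> \<le> 2 * \<eta> * real ((2 * R + 1)\<^sup>2) + 128 * (21 * b + 2 * \<eta>) * (harm (R + 1) / (harm R)\<^sup>2)"
proof -
  have "D (0 + \<alpha>) \<le> 2 * \<eta> * real ((2 * R + 1)\<^sup>2)
      + 128 * (5 * b + (2 * \<eta> + 16 * b)) * (harm (R + 1) / (harm R)\<^sup>2)"
  proof (rule dissipation_zero_le[where D = "\<lambda>\<beta>. D (\<beta> + \<alpha>)" and F = "\<lambda>\<beta>. F (\<beta> + \<alpha>)", OF dim b \<eta> D0 _ F _ R])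
    show "D (\<beta> + \<alpha>) \<le> 2 * \<eta> + 16 * b" for \<beta> by (rule dissipation_le[OF dim b D0 bdd F div])
    show "D (\<beta> + \<alpha>) \<le> \<eta> + lattice_div (\<lambda>\<beta>. F (\<beta> + \<alpha>)) \<beta>" for \<beta>
      using div[of "\<beta> + \<alpha>"] by (simp add: lattice_div_def algebra_simps)
  qed
  then show ?thesis by (simp add: algebra_simps)
qed

text \<open>For \<open>R \<ge> 1\<close> the added reciprocal is at most
  \<open>1 \<le> harm R\<close>, so \<open>harm (R + 1) \<le> 2 * harm R\<close>, and divergence of
  the harmonic series finishes.\<close>

lemma harm_ratio_tendsto_0: "(\<lambda>R. harm (R + 1) / (harm R)\<^sup>2 :: real) \<longlonglongrightarrow> 0"
proof (rule tendsto_sandwich[where f = "\<lambda>_. 0" and h = "\<lambda>R. 2 * inverse (harm R)"])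
  show "\<forall>\<^sub>F R in sequentially. harm (R + 1) / (harm R)\<^sup>2 \<le> 2 * inverse (harm R :: real)"
    using eventually_gt_at_top[of 0]
  proof eventually_elim
    case (elim R)
    have h: "(0::real) < harm R" using elim by (simp add: harm_pos)
    have "(1::real) = harm 1" by (simp add: harm_def)
    also have "(harm 1::real) \<le> harm R" using elim by (intro harm_mono) simp
    finally have "harm (R + 1) \<le> (2 * harm R :: real)"
      by (simp add: harm_Suc inverse_eq_divide) (smt (verit) divide_le_eq_1 of_nat_0_le_iff)
    then show ?case using h by (simp add: field_simps power2_eq_square)
  qed
  have "filterlim (harm :: nat \<Rightarrow> real) at_top sequentially" by (rule harm_at_top)
  then have "(\<lambda>R. inverse (harm R :: real)) \<longlonglongrightarrow> 0" by (rule tendsto_inverse_0_at_top)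
  then show "(\<lambda>R. 2 * inverse (harm R :: real)) \<longlonglongrightarrow> 0" using tendsto_mult_right_zero by fastforce
qed (auto simp: harm_nonneg)

section \<open>Time averages along an orbit\<close>

lemma norm_le_sup_norm: "g \<in> l_infinity \<Longrightarrow> norm (g \<alpha>) \<le> sup_norm g"
  unfolding sup_norm_def l_infinity_def
  by (intro cSUP_upper) (auto simp: bounded_iff bdd_above_def)

text \<open>Nonnegativity of the variance: integrate \<open>(q - m)\<^sup>2\<close> with
  \<open>m\<close> the mean. This lets the quadratic flux bound survive time averaging.\<close>

lemma mean_square_le:
  fixes q :: "real \<Rightarrow> real"
  assumes T: "0 < T" and q: "continuous_on {0..T} q"
  shows "(integral {0..T} q / T)\<^sup>2 \<le> integral {0..T} (\<lambda>t. (q t)\<^sup>2) / T"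
proof -
  define m where "m = integral {0..T} q / T"
  have i1: "(q has_integral m * T) {0..T}"
    using integrable_integral[OF integrable_continuous_real[OF q]] T by (simp add: m_def)
  have i2: "((\<lambda>t. (q t)\<^sup>2) has_integral integral {0..T} (\<lambda>t. (q t)\<^sup>2)) {0..T}"
    by (intro integrable_integral integrable_continuous_real continuous_intros q)
  have i3: "((\<lambda>t. m\<^sup>2) has_integral m\<^sup>2 * T) {0..T}"
    using has_integral_const_real[of "m\<^sup>2" 0 T] T by (simp add: mult.commute)
  have "((\<lambda>t. (q t)\<^sup>2 - 2 * m * q t + m\<^sup>2) has_integral
      integral {0..T} (\<lambda>t. (q t)\<^sup>2) - 2 * m * (m * T) + m\<^sup>2 * T) {0..T}"
    by (intro has_integral_add has_integral_diff has_integral_mult_right i1 i2 i3)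
  moreover have "0 \<le> (q t)\<^sup>2 - 2 * m * q t + m\<^sup>2" for t
    using zero_le_power2[of "q t - m"] by (simp add: power2_diff algebra_simps)
  ultimately have "0 \<le> integral {0..T} (\<lambda>t. (q t)\<^sup>2) - 2 * m * (m * T) + m\<^sup>2 * T"
    by (rule has_integral_nonneg)
  then show ?thesis using T unfolding m_def[symmetric] by (simp add: field_simps power2_eq_square)
qed

context continuous_semiflow
begin

lemma flow_in_topspace: "u \<in> topspace X \<Longrightarrow> 0 \<le> t \<Longrightarrow> \<phi> u t \<in> topspace X"
  using continuous_map_image_subset_topspace[OF continuous_flow] by force

lemma continuous_map_orbit:
  assumes "u \<in> topspace X" shows "continuous_map (top_of_set {0..}) X (\<phi> u)"
proof -
  have "continuous_map (top_of_set {0..}) (prod_topology X (top_of_set {0..})) (\<lambda>t. (u, t))"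
    using assms by (intro continuous_map_pairedI) auto
  from continuous_map_compose[OF this continuous_flow] show ?thesis by (simp add: o_def)
qed

lemma continuous_on_orbit:
  assumes "u \<in> topspace X" "continuous_map X euclideanreal q"
  shows "continuous_on {0..} (\<lambda>t. q (\<phi> u t))"
  using continuous_map_compose[OF continuous_map_orbit[OF assms(1)] assms(2)] by (simp add: o_def)

text \<open>Provides measurability of the visiting times. The equivalence is limited to
  \<open>t \<ge> 0\<close> because the flow is unspecified at negative times.\<close>

lemma orbit_hits_borel:
  assumes "u \<in> topspace X" "openin X U"
  obtains V where "open V" "\<And>t. 0 \<le> t \<Longrightarrow> \<phi> u t \<in> U \<longleftrightarrow> t \<in> V"
proof -
  have "openin (top_of_set {0..}) {t \<in> topspace (top_of_set {0..}). \<phi> u t \<in> U}"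
    using continuous_map_orbit[OF assms(1)] assms(2) by (rule openin_continuous_map_preimage)
  then obtain V where V: "open V" "{t \<in> {0..}. \<phi> u t \<in> U} = {0..} \<inter> V"
    by (auto simp: openin_open)
  show thesis
  proof (rule that[OF V(1)])
    fix t :: real assume "0 \<le> t"
    then show "\<phi> u t \<in> U \<longleftrightarrow> t \<in> V" using V(2) by auto
  qed
qed

end

context lattice_EDS
begin

lemma energy_identity:
  assumes u: "u \<in> topspace X" and T: "0 < T"
  shows "integral {0..T} (\<lambda>t. d (\<phi> u t) \<alpha>) / T = (e u \<alpha> - e (\<phi> u T) \<alpha>) / T
    + lattice_div (\<lambda>\<beta>. \<chi> j. integral {0..T} (\<lambda>t. f (\<phi> u t) \<beta> $ j) / T) \<alpha>"
proof -
  have cd: "continuous_on {0..} (\<lambda>t. d (\<phi> u t) \<alpha>)" by (rule continuous_on_orbit[OF u continuous_dissipation])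
  have cf: "continuous_on {0..} (\<lambda>t. f (\<phi> u t) \<beta> $ j)" for \<beta> j
    by (rule continuous_on_orbit[OF u continuous_flux])
  let ?I = "\<lambda>\<beta> j. integral {0..T} (\<lambda>t. f (\<phi> u t) \<beta> $ j)"
  have "e (\<phi> u T) \<alpha> - e (\<phi> u 0) \<alpha>
      = integral {0..T} (\<lambda>t. - d (\<phi> u t) \<alpha> + lattice_div (f (\<phi> u t)) \<alpha>)"
  proof (rule distributional_derivative_imp_integral[OF _ _ energy_balance[OF u]])
    show "continuous_on {0..} (\<lambda>t. e (\<phi> u t) \<alpha>)" by (rule continuous_on_orbit[OF u continuous_energy])
    show "continuous_on {0..} (\<lambda>t. - d (\<phi> u t) \<alpha> + lattice_div (f (\<phi> u t)) \<alpha>)"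
      unfolding lattice_div_def by (intro continuous_intros cd cf)
  qed (use T in simp)
  also have "\<dots> = - integral {0..T} (\<lambda>t. d (\<phi> u t) \<alpha>) + (\<Sum>j\<in>UNIV. ?I \<alpha> j - ?I (\<alpha> - axis j 1) j)"
    unfolding lattice_div_def
    by (intro integral_unique has_integral_add has_integral_neg has_integral_sum has_integral_diff
        integrable_integral integrable_continuous_real continuous_on_subset[OF cd]
        continuous_on_subset[OF cf]) auto
  finally have "integral {0..T} (\<lambda>t. d (\<phi> u t) \<alpha>)
      = (e u \<alpha> - e (\<phi> u T) \<alpha>) + (\<Sum>j\<in>UNIV. ?I \<alpha> j - ?I (\<alpha> - axis j 1) j)"
    using flow_zero[OF u] by simp
  then show ?thesis
    by (simp add: lattice_div_def add_divide_distrib sum_divide_distrib diff_divide_distrib)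
qed

text \<open>Continuity at each site would not give a bound uniform in the site; continuity of the
  sup norm on the compact interval does. The bound may depend on \<open>T\<close>, since
  \<open>dissipation_le\<close> uses it only qualitatively.\<close>

lemma mean_dissipation_bdd_above:
  assumes u: "u \<in> topspace X" and T: "0 < T"
  shows "bdd_above (range (\<lambda>\<alpha>. integral {0..T} (\<lambda>t. d (\<phi> u t) \<alpha>) / T))"
proof -
  have "bounded ((\<lambda>t. sup_norm (d (\<phi> u t))) ` {0..T})"
    by (intro compact_imp_bounded compact_continuous_image
        continuous_on_subset[OF continuous_dissipation_norm[OF u]]) auto
  then obtain K where K: "\<And>t. t \<in> {0..T} \<Longrightarrow> \<bar>sup_norm (d (\<phi> u t))\<bar> \<le> K"
    by (auto simp: bounded_iff) fastforce
  have "integral {0..T} (\<lambda>t. d (\<phi> u t) \<alpha>) / T \<le> K" for \<alpha>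
  proof -
    have "d (\<phi> u t) \<alpha> \<le> K" if "t \<in> {0..T}" for t
      using norm_le_sup_norm[OF dissipation_l_infinity[OF flow_in_topspace[OF u]], of t \<alpha>] K[OF that] that
      by auto
    then have "integral {0..T} (\<lambda>t. d (\<phi> u t) \<alpha>) \<le> integral {0..T} (\<lambda>t. K)"
      by (intro integral_le integrable_continuous_real continuous_intros
          continuous_on_subset[OF continuous_on_orbit[OF u continuous_dissipation]]) auto
    then show ?thesis using T by (simp add: divide_le_eq mult.commute)
  qed
  then show ?thesis by (intro bdd_aboveI) auto
qed

end

section \<open>Decay of the mean dissipation and time spent near equilibria\<close>

context bounded_lattice_EDS
begin

text \<open>The order of choices is essential: first \<open>R\<close> makes the Dirichlet term small
  uniformly in \<open>T \<ge> 1\<close>, then \<open>T\<close> is taken large to beat the size of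
  the box of radius \<open>R\<close>.\<close>

lemma mean_dissipation_tendsto_0:
  assumes dim: "CARD('n) \<le> 2" and u: "u \<in> topspace X"
  shows "((\<lambda>T. integral {0..T} (\<lambda>t. d (\<phi> u t) \<alpha>) / T) \<longlongrightarrow> 0) at_top"
proof -
  obtain E where E: "\<And>v. v \<in> topspace X \<Longrightarrow> sup_norm (e v) \<le> E"
    using bounded_energy by (auto simp: bdd_above_def)
  have eE: "e v \<beta> \<le> E" if "v \<in> topspace X" for v \<beta>
    using norm_le_sup_norm[OF energy_l_infinity[OF that], of \<beta>] E[OF that] by auto
  have E0: "0 \<le> E" using eE[OF u] energy_nonneg[OF u] by (meson order_trans)
  obtain b where b: "mono_on {0..} b" "\<And>x. 0 \<le> x \<Longrightarrow> 0 \<le> b x"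
    "\<And>v \<beta>. v \<in> topspace X \<Longrightarrow> (norm (f v \<beta>))\<^sup>2 \<le> b (sup_norm (e v)) * d v \<beta>"
    using flux_bound by blast
  define B where "B = b E"
  have B0: "0 \<le> B" using b(2) E0 by (simp add: B_def)
  have fB: "(f v \<beta> $ j)\<^sup>2 \<le> B * d v \<beta>" if v: "v \<in> topspace X" for v \<beta> j
  proof -
    have "0 \<le> sup_norm (e v)"
      using norm_le_sup_norm[OF energy_l_infinity[OF v]] norm_ge_zero order_trans by blast
    \<comment> \<open>Monotonicity of \<open>b\<close> and the global energy bound give a single
      flux constant for the whole space.\<close>
    then have "b (sup_norm (e v)) \<le> B"
      unfolding B_def using b(1) E[OF v] E0 by (auto simp: mono_on_def)
    then have "(norm (f v \<beta>))\<^sup>2 \<le> B * d v \<beta>"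
      using b(3)[OF v, of \<beta>] mult_right_mono[OF _ dissipation_nonneg[OF v]] order_trans by blast
    moreover have "(f v \<beta> $ j)\<^sup>2 \<le> (norm (f v \<beta>))\<^sup>2"
      using component_le_norm_cart[of "f v \<beta>" j] by (metis abs_ge_zero power2_abs power_mono)
    ultimately show ?thesis by linarith
  qed
  let ?D = "\<lambda>T \<beta>. integral {0..T} (\<lambda>t. d (\<phi> u t) \<beta>) / T"
  let ?F = "\<lambda>T \<beta>. \<chi> j. integral {0..T} (\<lambda>t. f (\<phi> u t) \<beta> $ j) / T"
  have id: "(\<lambda>t. d (\<phi> u t) \<beta>) integrable_on {0..T}" for T \<beta>
    by (intro integrable_continuous_real continuous_on_subset[OF continuous_on_orbit[OF u continuous_dissipation]]) auto
  have cf: "continuous_on {0..T} (\<lambda>t. f (\<phi> u t) \<beta> $ j)" for T \<beta> j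
    by (rule continuous_on_subset[OF continuous_on_orbit[OF u continuous_flux]]) auto
  have D0: "0 \<le> ?D T \<beta>" if "0 < T" for T \<beta>
    using that by (intro divide_nonneg_nonneg integral_nonneg id dissipation_nonneg flow_in_topspace u) auto
  have F: "(?F T \<beta> $ j)\<^sup>2 \<le> B * ?D T \<beta>" if T: "0 < T" for T \<beta> j
  proof -
    have "(?F T \<beta> $ j)\<^sup>2 \<le> integral {0..T} (\<lambda>t. (f (\<phi> u t) \<beta> $ j)\<^sup>2) / T"
      using mean_square_le[OF T cf] by simp
    also have "\<dots> \<le> integral {0..T} (\<lambda>t. B * d (\<phi> u t) \<beta>) / T"
      using T by (intro divide_right_mono integral_le integrable_continuous_real continuous_intros cf fB flow_in_topspace u
          continuous_on_subset[OF continuous_on_orbit[OF u continuous_dissipation]]) auto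
    finally show ?thesis by simp
  qed
  have div: "?D T \<beta> \<le> E / T + lattice_div (?F T) \<beta>" if T: "0 < T" for T \<beta>
  proof -
    have "(e u \<beta> - e (\<phi> u T) \<beta>) / T \<le> E / T"
      using T eE[OF u, of \<beta>] energy_nonneg[OF flow_in_topspace[OF u], of T \<beta>]
      by (intro divide_right_mono) auto
    then show ?thesis using energy_identity[OF u T, of \<beta>] by simp
  qed
  have est: "?D T \<alpha> \<le> 2 * (E / T) * real ((2 * R + 1)\<^sup>2) + 128 * (21 * B + 2 * E) * (harm (R + 1) / (harm R)\<^sup>2)"
    if T: "1 \<le> T" and R: "1 \<le> R" for T R
  proof -
    have T0: "0 < T" using T by simp
    have "?D T \<alpha> \<le> 2 * (E / T) * real ((2 * R + 1)\<^sup>2) + 128 * (21 * B + 2 * (E / T)) * (harm (R + 1) / (harm R)\<^sup>2)"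
      by (rule dissipation_at_le[OF dim B0 _ D0[OF T0] mean_dissipation_bdd_above[OF u T0] F[OF T0] div[OF T0] R])
        (use E0 T in simp)
    \<comment> \<open>Replacing \<open>E / T\<close> by \<open>E\<close> removes \<open>T\<close>
      from the Dirichlet term, so that \<open>R\<close> can be fixed before
      \<open>T\<close>.\<close>
    also have "E / T \<le> E" using E0 T by (simp add: divide_le_eq mult_left_le mult_le_cancel_left1)
    then have "128 * (21 * B + 2 * (E / T)) * (harm (R + 1) / (harm R)\<^sup>2)
        \<le> 128 * (21 * B + 2 * E) * (harm (R + 1) / (harm R)\<^sup>2)"
      by (intro mult_right_mono) (auto simp: harm_nonneg)
    finally show ?thesis by simp
  qed
  show ?thesis
  proof (rule order_tendstoI)
    fix y :: real assume "y < 0"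
    then show "\<forall>\<^sub>F T in at_top. y < ?D T \<alpha>"
      by (intro eventually_mono[OF eventually_gt_at_top[of 0]]) (use D0 order_less_le_trans in blast)
  next
    fix y :: real assume y: "0 < y"
    have "(\<lambda>R. 128 * (21 * B + 2 * E) * (harm (R + 1) / (harm R)\<^sup>2)) \<longlonglongrightarrow> 0"
      using tendsto_mult_right_zero[OF harm_ratio_tendsto_0] by blast
    then have "\<forall>\<^sub>F R in sequentially. 128 * (21 * B + 2 * E) * (harm (R + 1) / (harm R)\<^sup>2) < y / 2"
      using y by (intro order_tendstoD) auto
    then have "\<forall>\<^sub>F R in sequentially. 1 \<le> R \<and> 128 * (21 * B + 2 * E) * (harm (R + 1) / (harm R)\<^sup>2) < y / 2"
      using eventually_ge_at_top[of 1] by eventually_elim simp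
    then obtain R :: nat where R: "1 \<le> R" "128 * (21 * B + 2 * E) * (harm (R + 1) / (harm R)\<^sup>2) < y / 2"
      by (auto dest!: eventually_happens)
    have "((\<lambda>T::real. 2 * (E / T) * real ((2 * R + 1)\<^sup>2)) \<longlongrightarrow> 2 * 0 * real ((2 * R + 1)\<^sup>2)) at_top"
      by (intro tendsto_intros tendsto_divide_0[OF tendsto_const] filterlim_at_top_imp_at_infinity filterlim_ident)
    then have "\<forall>\<^sub>F T in at_top. 2 * (E / T) * real ((2 * R + 1)\<^sup>2) < y / 2"
      using y by (intro order_tendstoD) auto
    then show "\<forall>\<^sub>F T in at_top. ?D T \<alpha> < y"
      using eventually_ge_at_top[of 1]
    proof eventually_elim
      case (elim T)
      then show ?case using est[of T R] R by linarith
    qed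
  qed
qed

text \<open>A point outside \<open>U\<close> is not stationary, so some site dissipates more than
  some \<open>1 / (n + 1)\<close>. These open conditions cover the compact complement of
  \<open>U\<close>; a finite subcover gives \<open>\<Lambda>\<close>, and the weight
  \<open>n + 1\<close> makes the detecting term at least 1.\<close>

lemma indicator_complement_le_dissipation:
  assumes "compact_space X" "openin X U" "equilibria X \<phi> \<subseteq> U"
  obtains \<Lambda> :: "((int ^ 'n) \<times> nat) set" where "finite \<Lambda>"
    "\<And>v. v \<in> topspace X \<Longrightarrow> 1 - indicator U v \<le> (\<Sum>(\<alpha>, n)\<in>\<Lambda>. real (n + 1) * d v \<alpha>)"
proof -
  define W where "W = (\<lambda>(\<alpha>, n). {v \<in> topspace X. d v \<alpha> \<in> {1 / real (n + 1)<..}})"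
  have W: "openin X (W p)" for p
    unfolding W_def case_prod_beta
    by (rule openin_continuous_map_preimage[OF continuous_dissipation]) (simp flip: open_openin)
  have "compactin X (topspace X - U)"
    using assms(1,2) by (intro closedin_compact_space) auto
  moreover have "topspace X - U \<subseteq> \<Union> (range W)"
  proof
    fix v assume v: "v \<in> topspace X - U"
    then have "\<not> stationary \<phi> v" using assms(3) by (auto simp: equilibria_def)
    then obtain \<alpha> where "d v \<alpha> \<noteq> 0" using no_dissipation_stationary v by blast
    then have "0 < d v \<alpha>" using dissipation_nonneg[of v \<alpha>] v by simp
    then obtain n where "1 / real (n + 1) < d v \<alpha>" using nat_approx_posE by (metis Suc_eq_plus1)
    then have "v \<in> W (\<alpha>, n)" using v by (simp add: W_def)
    then show "v \<in> \<Union> (range W)" by blast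
  qed
  ultimately obtain \<F> where \<F>: "finite \<F>" "\<F> \<subseteq> range W" "topspace X - U \<subseteq> \<Union> \<F>"
    using W unfolding compactin_def by (metis (no_types, lifting) imageE)
  then obtain \<Lambda> where \<Lambda>: "finite \<Lambda>" "\<F> = W ` \<Lambda>" by (meson finite_subset_image)
  show thesis
  proof (rule that[OF \<Lambda>(1)])
    fix v assume v: "v \<in> topspace X"
    have nn: "0 \<le> (case p of (\<alpha>, n) \<Rightarrow> real (n + 1) * d v \<alpha>)" for p
      by (cases p) (simp add: dissipation_nonneg[OF v])
    show "1 - indicator U v \<le> (\<Sum>(\<alpha>, n)\<in>\<Lambda>. real (n + 1) * d v \<alpha>)"
    proof (cases "v \<in> U")
      case True then show ?thesis using nn by (simp add: sum_nonneg)
    next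
      case False
      then obtain \<alpha> n where p: "(\<alpha>, n) \<in> \<Lambda>" "v \<in> W (\<alpha>, n)" using \<F>(3) \<Lambda>(2) v by force
      then have "1 \<le> real (n + 1) * d v \<alpha>" by (simp add: W_def field_simps)
      also have "\<dots> \<le> (\<Sum>(\<alpha>, n)\<in>\<Lambda>. real (n + 1) * d v \<alpha>)"
        using member_le_sum[where f = "\<lambda>(\<alpha>, n). real (n + 1) * d v \<alpha>", OF p(1) nn \<Lambda>(1)] by simp
      finally show ?thesis using False by simp
    qed
  qed
qed

text \<open>Averaging the pointwise bound over the orbit controls the fraction of time outside
  \<open>U\<close> by finitely many mean dissipations, each tending to 0; the trivial upper bound 1
  closes the sandwich.\<close>

lemma time_near_equilibria_tendsto_1:
  assumes dim: "CARD('n) \<le> 2" and X: "compact_space X" and U: "openin X U" "equilibria X \<phi> \<subseteq> U"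
    and u: "u \<in> topspace X"
  shows "((\<lambda>T. (1 / T) * (LINT t:{0..T}|lborel. indicator U (\<phi> u t))) \<longlongrightarrow> (1::real)) at_top"
proof -
  obtain \<Lambda> :: "((int ^ 'n) \<times> nat) set" where \<Lambda>: "finite \<Lambda>"
    "\<And>v. v \<in> topspace X \<Longrightarrow> 1 - indicator U v \<le> (\<Sum>(\<alpha>, n)\<in>\<Lambda>. real (n + 1) * d v \<alpha>)"
    using indicator_complement_le_dissipation[OF X U] by blast
  obtain V where V: "open V" "\<And>t. 0 \<le> t \<Longrightarrow> \<phi> u t \<in> U \<longleftrightarrow> t \<in> V" using orbit_hits_borel[OF u U(1)] by blast
  let ?L = "\<lambda>T. LINT t:{0..T}|lborel. (indicator U (\<phi> u t) :: real)"
  let ?S = "\<lambda>t. \<Sum>(\<alpha>, n)\<in>\<Lambda>. real (n + 1) * d (\<phi> u t) \<alpha>"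
  have cd: "continuous_on {0..T} (\<lambda>t. d (\<phi> u t) \<alpha>)" for T \<alpha>
    by (rule continuous_on_subset[OF continuous_on_orbit[OF u continuous_dissipation]]) auto
  have ind: "set_integrable lborel {0..T} (\<lambda>t. indicator U (\<phi> u t) :: real)" for T
  proof -
    have "integrable lborel (indicator ({0..T} \<inter> V) :: real \<Rightarrow> real)"
    proof (rule integrable_real_indicator)
      show "{0..T} \<inter> V \<in> sets lborel" using V(1) by simp
      show "emeasure lborel ({0..T} \<inter> V) < \<infinity>"
        by (intro emeasure_bounded_finite bounded_subset[OF bounded_closed_interval[of 0 T]]) auto
    qed
    \<comment> \<open>The factor \<open>indicator {0..T}\<close> hides the negative times, where
      \<open>V\<close> and the orbit need not agree.\<close>
    also have "(indicator ({0..T} \<inter> V) :: real \<Rightarrow> real) = (\<lambda>t. indicator {0..T} t *\<^sub>R indicator U (\<phi> u t))"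
      using V(2) by (auto simp: indicator_def fun_eq_iff)
    finally show ?thesis unfolding set_integrable_def .
  qed
  have lower: "1 - (\<Sum>(\<alpha>, n)\<in>\<Lambda>. real (n + 1) * (integral {0..T} (\<lambda>t. d (\<phi> u t) \<alpha>) / T)) \<le> (1 / T) * ?L T"
    and upper: "(1 / T) * ?L T \<le> 1" if T: "0 < T" for T
  proof -
    have c: "continuous_on {0..T} (\<lambda>t. 1 - ?S t)"
      by (auto intro!: continuous_intros cd simp: case_prod_beta)
    have "T - (\<Sum>(\<alpha>, n)\<in>\<Lambda>. real (n + 1) * integral {0..T} (\<lambda>t. d (\<phi> u t) \<alpha>)) = integral {0..T} (\<lambda>t. 1 - ?S t)"
    proof (rule integral_unique[symmetric, OF has_integral_diff])
      show "((\<lambda>t. 1) has_integral T) {0..T}" using has_integral_const_real[of "1::real" 0 T] T by simp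
      show "(?S has_integral (\<Sum>(\<alpha>, n)\<in>\<Lambda>. real (n + 1) * integral {0..T} (\<lambda>t. d (\<phi> u t) \<alpha>))) {0..T}"
        unfolding case_prod_beta
        by (intro has_integral_sum \<Lambda>(1) has_integral_mult_right integrable_integral integrable_continuous_real cd)
    qed
    also have "\<dots> = (LINT t:{0..T}|lborel. 1 - ?S t)"
      by (rule set_borel_integral_eq_integral(2)[symmetric] borel_integrable_atLeastAtMost' c)+
    also have "\<dots> \<le> ?L T"
      using \<Lambda>(2)[OF flow_in_topspace[OF u]]
      by (intro set_integral_mono borel_integrable_atLeastAtMost' c ind) (auto simp: algebra_simps)
    finally have "(T - (\<Sum>(\<alpha>, n)\<in>\<Lambda>. real (n + 1) * integral {0..T} (\<lambda>t. d (\<phi> u t) \<alpha>))) / T \<le> ?L T / T"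
      using T by (intro divide_right_mono) auto
    then show "1 - (\<Sum>(\<alpha>, n)\<in>\<Lambda>. real (n + 1) * (integral {0..T} (\<lambda>t. d (\<phi> u t) \<alpha>) / T)) \<le> (1 / T) * ?L T"
      using T by (simp add: diff_divide_distrib sum_divide_distrib case_prod_beta)
    have "?L T \<le> (LINT t:{0..T}|lborel. 1)"
      by (intro set_integral_mono ind borel_integrable_atLeastAtMost' continuous_intros) (auto simp: indicator_def)
    also have "\<dots> = T" using T by (simp add: set_lebesgue_integral_def)
    finally show "(1 / T) * ?L T \<le> 1" using T by (simp add: divide_le_eq)
  qed
  have "((\<lambda>T. 1 - (\<Sum>(\<alpha>, n)\<in>\<Lambda>. real (n + 1) * (integral {0..T} (\<lambda>t. d (\<phi> u t) \<alpha>) / T)))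
      \<longlongrightarrow> 1 - (\<Sum>(\<alpha>, n)\<in>\<Lambda>. real (n + 1) * 0)) at_top"
    unfolding case_prod_beta by (intro tendsto_intros mean_dissipation_tendsto_0 dim u)
  then have "((\<lambda>T. 1 - (\<Sum>(\<alpha>, n)\<in>\<Lambda>. real (n + 1) * (integral {0..T} (\<lambda>t. d (\<phi> u t) \<alpha>) / T))) \<longlongrightarrow> 1) at_top"
    by simp
  from eventually_mono[OF eventually_gt_at_top[of 0] lower]
    eventually_mono[OF eventually_gt_at_top[of 0] upper] this tendsto_const
  show ?thesis by (rule tendsto_sandwich)
qed

end

theorem proposition1:
  fixes X :: "'x topology" and \<phi> :: "'x \<Rightarrow> real \<Rightarrow> 'x"
    and e d :: "'x \<Rightarrow> int ^ 'n \<Rightarrow> real"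
    and f :: "'x \<Rightarrow> int ^ 'n \<Rightarrow> real ^ 'n"
  assumes "bounded_lattice_EDS X \<phi> e d f"
    and "CARD('n) = 1 \<or> CARD('n) = 2"
    and "compact_space X"
    and "topspace X \<noteq> {}"
  shows "(\<forall>U. openin X U \<and> equilibria X \<phi> \<subseteq> U \<longrightarrow>
            (\<forall>u\<in>topspace X.
               ((\<lambda>T. (1 / T) * (LINT t:{0..T}|lborel. indicator U (\<phi> u t))) \<longlongrightarrow> (1::real)) at_top)) \<and>
         equilibria X \<phi> \<noteq> {}"
proof -
  interpret bounded_lattice_EDS X \<phi> e d f by fact
  have dim: "CARD('n) \<le> 2" using assms(2) by auto
  note lim = time_near_equilibria_tendsto_1[OF dim assms(3)]
  obtain u where u: "u \<in> topspace X" using assms(4) by blast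
  have "equilibria X \<phi> \<noteq> {}"
  proof
    \<comment> \<open>The empty set would then be an open neighbourhood of the equilibria, and the
      fraction of time spent in it is 0.\<close>
    assume "equilibria X \<phi> = {}"
    then have "((\<lambda>T. 0) \<longlongrightarrow> (1::real)) (at_top :: real filter)"
      using lim[of "{}" u] u by simp
    then show False by (simp add: tendsto_const_iff)
  qed
  then show ?thesis using lim by blast
qed

end
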